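(* Let $d\ge1$ and let $k,\ell$ be non-zero holomorphic kernels on a (connected) domain $\Omega\subseteq\mathbb{C}^d$. Then the pair $(k,\ell)$ has a Shimorin certificate if and only if it has a strong Shimorin certificate, in which case $k$ is non-vanishing (i.e. $k(z,w)\ne0$ for all $z,w\in\Omega$).
   Context: A kernel on a non-empty set $X$ is a function $k:X\times X\to\mathbb{C}$ such that $[k(z_i,z_j)]_{i,j=1}^n$ is positive semi-definite for all finite choices of points; $k_1\succeq k_2$ (or $k_2\preceq k_1$) means $k_1-k_2$ is a kernel; $\mathcal{H}_k$ is the reproducing kernel Hilbert space. Standing assumption: $k(x,x)\ne0\ne\ell(x,x)$ for all $x$. For $z\in X$, $k^z(w,v)=k(w,v)-\frac{k(w,z)k(z,v)}{k(z,z)}$, and similarly $\ell^z$. A domain is open, connected and non-empty; a holomorphic kernel on a domain is a kernel holomorphic in its first variable and conjugate holomorphic in its second. A Shimorin certificate for $(k,\ell)$ is a family of kernels $\{p[z]\}_{z\in X}$ on $X$ such that $\ell^z\succeq p[z]\ell$ and $k^z\preceq p[z]k$ for every $z\in X$ (pointwise products; the $p[z]$ may vanish on the diagonal). A strong Shimorin certificate for $(k,\ell)$ is a complete Pick kernel $s$ on $X$ for which there are kernels $h,g$ on $X$ with $k=(1-h)s$ and $\ell=sg$. (None of $p[z],s,h,g$ is assumed holomorphic.) A kernel $s$ on $X$ is a complete Pick kernel if for all $n,N\ge1$, all $z_1,\dots,z_n\in X$ and all complex $N\times N$ matrices $W_1,\dots,W_n$ with $[s(z_i,z_j)(I_{N\times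 N}-W_iW_j^* )]_{i,j=1}^n$ positive semi-definite, there is a function $\Phi:X\to\mathbb{M}_N$ (complex $N\times N$ matrices) which multiplies $\mathcal{H}_s\otimes\mathbb{C}^N$ into itself with multiplication operator of norm at most one and satisfies $\Phi(z_i)=W_i$ for all $i$. *)

theory Defs
  imports "HOL-Analysis.Analysis"
begin

section \<open>Kernels\<close>

text \<open>
  A kernel on \<open>X\<close> is a total function of type \<open>'a \<Rightarrow> 'a \<Rightarrow> complex\<close> together with the carrier set
  \<open>X\<close>; its values at points outside \<open>X\<close> are never used.  Over the complex numbers, a
  quadratic form that takes only real non-negative values has a Hermitian matrix, so Hermitian
  symmetry need not be listed separately.
\<close>

definition psd_matrix :: "'i set \<Rightarrow> ('i \<Rightarrow> 'i \<Rightarrow> complex) \<Rightarrow> bool" where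
  "psd_matrix I A \<longleftrightarrow>
     (\<forall>c. (\<Sum>i\<in>I. \<Sum>j\<in>I. cnj (c i) * A i j * c j) \<in> \<real>\<^sub>\<ge>\<^sub>0)"

definition kernel_on :: "'a set \<Rightarrow> ('a \<Rightarrow> 'a \<Rightarrow> complex) \<Rightarrow> bool" where
  "kernel_on X k \<longleftrightarrow>
     (\<forall>(n::nat) z. (\<forall>i<n. z i \<in> X) \<longrightarrow> psd_matrix {..<n} (\<lambda>i j. k (z i) (z j)))"

definition kernel_le :: "'a set \<Rightarrow> ('a \<Rightarrow> 'a \<Rightarrow> complex) \<Rightarrow> ('a \<Rightarrow> 'a \<Rightarrow> complex) \<Rightarrow> bool" where
  "kernel_le X k1 k2 \<longleftrightarrow> kernel_on X (\<lambda>w v. k2 w v - k1 w v)"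

definition kernel_at :: "('a \<Rightarrow> 'a \<Rightarrow> complex) \<Rightarrow> 'a \<Rightarrow> 'a \<Rightarrow> 'a \<Rightarrow> complex" where
  "kernel_at k z w v = k w v - k w z * k z v / k z z"


section \<open>Reproducing kernel Hilbert spaces and complete Pick kernels\<close>

text \<open>
  The predicate \<open>rkhs X s H ip\<close> says that the set of functions \<open>H\<close> with the inner product \<open>ip\<close>
  (linear in its first argument) is the Hilbert space of functions on \<open>X\<close> with reproducing
  kernel \<open>s\<close>.  A function on \<open>X\<close> is represented by its extension by zero.
  By the Moore--Aronszajn theorem, for a kernel \<open>s\<close> on \<open>X\<close> such a space exists, and \<open>H\<close> and the
  restriction of \<open>ip\<close> to \<open>H\<close> are uniquely determined by \<open>X\<close> and \<open>s\<close>.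
\<close>

definition kernel_section :: "'a set \<Rightarrow> ('a \<Rightarrow> 'a \<Rightarrow> complex) \<Rightarrow> 'a \<Rightarrow> 'a \<Rightarrow> complex" where
  "kernel_section X s w = (\<lambda>x. if x \<in> X then s x w else 0)"

definition ip_norm :: "(('a \<Rightarrow> complex) \<Rightarrow> ('a \<Rightarrow> complex) \<Rightarrow> complex) \<Rightarrow> ('a \<Rightarrow> complex) \<Rightarrow> real" where
  "ip_norm ip f = sqrt (Re (ip f f))"

locale rkhs =
  fixes X :: "'a set"
    and s :: "'a \<Rightarrow> 'a \<Rightarrow> complex"
    and H :: "('a \<Rightarrow> complex) set"
    and ip :: "('a \<Rightarrow> complex) \<Rightarrow> ('a \<Rightarrow> complex) \<Rightarrow> complex"
  assumes functions_on: "\<And>f x. f \<in> H \<Longrightarrow> x \<notin> X \<Longrightarrow> f x = 0"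
    and zero_mem: "(\<lambda>x. 0) \<in> H"
    and add_mem: "\<And>f g. f \<in> H \<Longrightarrow> g \<in> H \<Longrightarrow> (\<lambda>x. f x + g x) \<in> H"
    and scale_mem: "\<And>c f. f \<in> H \<Longrightarrow> (\<lambda>x. c * f x) \<in> H"
    and ip_add: "\<And>f g h. f \<in> H \<Longrightarrow> g \<in> H \<Longrightarrow> h \<in> H \<Longrightarrow>
                   ip (\<lambda>x. f x + g x) h = ip f h + ip g h"
    and ip_scale: "\<And>c f g. f \<in> H \<Longrightarrow> g \<in> H \<Longrightarrow> ip (\<lambda>x. c * f x) g = c * ip f g"
    and ip_cnj: "\<And>f g. f \<in> H \<Longrightarrow> g \<in> H \<Longrightarrow> ip g f = cnj (ip f g)"
    and ip_nonneg: "\<And>f. f \<in> H \<Longrightarrow> ip f f \<in> \<real>\<^sub>\<ge>\<^sub>0"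
    and ip_definite: "\<And>f. f \<in> H \<Longrightarrow> ip f f = 0 \<Longrightarrow> f = (\<lambda>x. 0)"
    and complete: "\<And>F :: nat \<Rightarrow> 'a \<Rightarrow> complex.
          (\<And>n. F n \<in> H) \<Longrightarrow>
          (\<And>e. e > 0 \<Longrightarrow> \<exists>M. \<forall>m\<ge>M. \<forall>n\<ge>M. ip_norm ip (\<lambda>x. F m x - F n x) < e) \<Longrightarrow>
          \<exists>f\<in>H. (\<lambda>n. ip_norm ip (\<lambda>x. F n x - f x)) \<longlonglongrightarrow> 0"
    and section_mem: "\<And>w. w \<in> X \<Longrightarrow> kernel_section X s w \<in> H"
    and reproducing: "\<And>f w. f \<in> H \<Longrightarrow> w \<in> X \<Longrightarrow> ip f (kernel_section X s w) = f w"

text \<open>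
  Since the size \<open>N\<close> of the matrices is quantified over below, a complex \<open>N \<times> N\<close> matrix is a
  function \<open>nat \<Rightarrow> nat \<Rightarrow> complex\<close> of which only the entries with both indices \<open>< N\<close> are used.
  Elements of the tensor product of \<open>H\<close> with \<open>\<complex>\<^sup>N\<close> are families \<open>(F b)\<close>, \<open>b < N\<close>, of elements of
  \<open>H\<close>, the square of the norm being the sum of the squares of the norms of the components.
\<close>

definition mult_op :: "nat \<Rightarrow> ('a \<Rightarrow> nat \<Rightarrow> nat \<Rightarrow> complex) \<Rightarrow> (nat \<Rightarrow> 'a \<Rightarrow> complex) \<Rightarrow>
    nat \<Rightarrow> 'a \<Rightarrow> complex" where
  "mult_op N \<Phi> F = (\<lambda>a x. \<Sum>b<N. \<Phi> x a b * F b x)"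

definition tensor_norm :: "(('a \<Rightarrow> complex) \<Rightarrow> ('a \<Rightarrow> complex) \<Rightarrow> complex) \<Rightarrow> nat \<Rightarrow>
    (nat \<Rightarrow> 'a \<Rightarrow> complex) \<Rightarrow> real" where
  "tensor_norm ip N F = sqrt (\<Sum>b<N. (ip_norm ip (F b))\<^sup>2)"

definition contractive_multiplier :: "'a set \<Rightarrow> ('a \<Rightarrow> 'a \<Rightarrow> complex) \<Rightarrow> nat \<Rightarrow>
    ('a \<Rightarrow> nat \<Rightarrow> nat \<Rightarrow> complex) \<Rightarrow> bool" where
  "contractive_multiplier X s N \<Phi> \<longleftrightarrow>
     (\<exists>H ip. rkhs X s H ip \<and>
        (\<forall>F. (\<forall>b<N. F b \<in> H) \<longrightarrow>
             (\<forall>a<N. mult_op N \<Phi> F a \<in> H) \<and>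
             tensor_norm ip N (mult_op N \<Phi> F) \<le> tensor_norm ip N F))"

text \<open>
  The block matrix with \<open>N \<times> N\<close> blocks \<open>s (z i) (z j) (I - W i (W j)\<^sup>*)\<close> is indexed by pairs
  (block index, index within the block).
\<close>

definition pick_matrix :: "('a \<Rightarrow> 'a \<Rightarrow> complex) \<Rightarrow> nat \<Rightarrow> (nat \<Rightarrow> 'a) \<Rightarrow>
    (nat \<Rightarrow> nat \<Rightarrow> nat \<Rightarrow> complex) \<Rightarrow> nat \<times> nat \<Rightarrow> nat \<times> nat \<Rightarrow> complex" where
  "pick_matrix s N z W = (\<lambda>(i, a) (j, b).
     s (z i) (z j) * ((if a = b then 1 else 0) - (\<Sum>c<N. W i a c * cnj (W j b c))))"

definition complete_pick_kernel :: "'a set \<Rightarrow> ('a \<Rightarrow> 'a \<Rightarrow> complex) \<Rightarrow> bool" where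
  "complete_pick_kernel X s \<longleftrightarrow> kernel_on X s \<and>
     (\<forall>n N z W. n \<ge> 1 \<longrightarrow> N \<ge> 1 \<longrightarrow> (\<forall>i<n. z i \<in> X) \<longrightarrow>
        psd_matrix ({..<n} \<times> {..<N}) (pick_matrix s N z W) \<longrightarrow>
        (\<exists>\<Phi>. contractive_multiplier X s N \<Phi> \<and>
             (\<forall>i<n. \<forall>a<N. \<forall>b<N. \<Phi> (z i) a b = W i a b)))"


section \<open>Shimorin certificates\<close>

definition has_shimorin_certificate ::
    "'a set \<Rightarrow> ('a \<Rightarrow> 'a \<Rightarrow> complex) \<Rightarrow> ('a \<Rightarrow> 'a \<Rightarrow> complex) \<Rightarrow> bool" where
  "has_shimorin_certificate X k l \<longleftrightarrow>
     (\<exists>p :: 'a \<Rightarrow> 'a \<Rightarrow> 'a \<Rightarrow> complex. \<forall>z\<in>X.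
        kernel_on X (p z) \<and>
        kernel_le X (\<lambda>w v. p z w v * l w v) (kernel_at l z) \<and>
        kernel_le X (kernel_at k z) (\<lambda>w v. p z w v * k w v))"

definition has_strong_shimorin_certificate ::
    "'a set \<Rightarrow> ('a \<Rightarrow> 'a \<Rightarrow> complex) \<Rightarrow> ('a \<Rightarrow> 'a \<Rightarrow> complex) \<Rightarrow> bool" where
  "has_strong_shimorin_certificate X k l \<longleftrightarrow>
     (\<exists>s. complete_pick_kernel X s \<and>
        (\<exists>h g. kernel_on X h \<and> kernel_on X g \<and>
           (\<forall>w\<in>X. \<forall>v\<in>X. k w v = (1 - h w v) * s w v \<and> l w v = s w v * g w v)))"


section \<open>Holomorphic kernels\<close>

text \<open>
  Holomorphy in several variables is complex Frechet differentiability: the real derivative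
  exists at every point and is complex linear.
\<close>

definition holomorphic_on_Cd :: "(complex ^ 'd \<Rightarrow> complex) \<Rightarrow> (complex ^ 'd) set \<Rightarrow> bool" where
  "holomorphic_on_Cd f \<Omega> \<longleftrightarrow>
     (\<forall>z\<in>\<Omega>. \<exists>f'. (f has_derivative f') (at z within \<Omega>) \<and> (\<forall>c v. f' (c *s v) = c * f' v))"

definition domain_Cd :: "(complex ^ 'd) set \<Rightarrow> bool" where
  "domain_Cd \<Omega> \<longleftrightarrow> open \<Omega> \<and> connected \<Omega> \<and> \<Omega> \<noteq> {}"

definition holomorphic_kernel ::
    "(complex ^ 'd) set \<Rightarrow> (complex ^ 'd \<Rightarrow> complex ^ 'd \<Rightarrow> complex) \<Rightarrow> bool" where
  "holomorphic_kernel \<Omega> k \<longleftrightarrow> kernel_on \<Omega> k \<and>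
     (\<forall>v\<in>\<Omega>. holomorphic_on_Cd (\<lambda>w. k w v) \<Omega>) \<and>
     (\<forall>w\<in>\<Omega>. holomorphic_on_Cd (\<lambda>v. cnj (k w v)) \<Omega>)"

end

theory Submission
  imports Defs "HOL-Complex_Analysis.Conformal_Mappings"
begin

text \<open>
  Both certificates are statements about one base point at a time, and kernels of the form
  \<open>s(w,v) = f(w) f(v)\<^sup>* / (1 - p(w,v))\<close> translate one into the other.  If \<open>p\<close> is a kernel with
  \<open>p(w,w) < 1\<close> and \<open>f\<close> has no zeros, such an \<open>s\<close> is a complete Pick kernel
  (\<open>complete_pick_kernel_geometric\<close>); conversely, if \<open>s\<close> is a complete Pick kernel without zeros, then
  \<open>p = s\<^sup>z / s\<close>, with \<open>s\<^sup>z = kernel_at s z\<close>, is a kernel for every base point \<open>z\<close>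
  (\<open>complete_pick_kernel_quotient\<close>).  This is the
  theorem of McCullough, Quiggin, Agler and McCarthy.

  From a Shimorin certificate to a strong one (\<open>strong_if_shimorin_at\<close>), a single base point \<open>z\<close> is
  enough.  With \<open>p = p[z]\<close> the two conditions read: \<open>(1 - p) l\<close> dominates
  \<open>l(w,z) l(z,v) / l(z,z)\<close>, and \<open>(1 - p) k\<close> is dominated by \<open>k(w,z) k(z,v) / k(z,z)\<close>.  With
  \<open>f = k(.,z) / sqrt (k(z,z))\<close> they say exactly that \<open>1 - k / s\<close> is a kernel and imply that \<open>l / s\<close> is
  one.  What has to be known is that \<open>p(w,w) < 1\<close> and \<open>k(w,z) \<noteq> 0\<close> for all \<open>w\<close>, and here holomorphy is
  used (\<open>shimorin_multiplier_less_one\<close>).  The first condition gives \<open>p(w,w) \<le> 1\<close>, with strict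
  inequality where \<open>l(w,z) \<noteq> 0\<close>.  If \<open>p(w,w) = 1\<close>, then the off-diagonal entries of the same condition give
  \<open>p(v,w) = 1\<close> for all \<open>v\<close> near \<open>w\<close>, so \<open>p(v,v) \<ge> 1\<close> and \<open>l(v,z) = 0\<close> near \<open>w\<close>, contradicting the
  identity theorem.  The second condition on the diagonal now shows that \<open>k\<close> has no zeros.

  From a strong certificate to a Shimorin certificate (\<open>shimorin_if_strong\<close>), take
  \<open>p[z] = s\<^sup>z / s\<close>.  Then \<open>l\<^sup>z - p[z] l\<close> and \<open>p[z] k - k\<^sup>z\<close> are products of the
  rank one kernel \<open>s(w,z) s(z,v) / s(z,z)\<close> with kernels built from \<open>g\<close> and from \<open>h\<close>.  The division needs
  \<open>s\<close> to have no zeros: for a complete Pick kernel, \<open>s(w,v) \<noteq> 0\<close> is an equivalence relation in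
  \<open>w\<close> and \<open>v\<close>; as \<open>k\<close> is continuous in its first variable and \<open>k = (1 - h) s\<close> is non-zero on the diagonal,
  its classes are open, and the domain is connected (\<open>strong_factor_nonvanishing\<close>).

  The complete Pick property speaks of multipliers of a Hilbert space.  The bridge to kernels is the
  construction of that space from its kernel, and the fact that \<open>\<Phi>\<close> is a contractive multiplier if and
  only if \<open>s(x,y) (I - \<Phi>(x) \<Phi>(y)\<^sup>*)\<close> is a kernel (\<open>contractive_multiplier_if_kernel\<close>,
  \<open>kernel_if_contractive_multiplier\<close>).
\<close>

section \<open>Positive semi-definite kernels\<close>

lemma psd_matrix_restrict:
  assumes "finite I" "psd_matrix I A" "J \<subseteq> I"
  shows "psd_matrix J A"
  unfolding psd_matrix_def
proof
  fix c :: "_ \<Rightarrow> complex"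
  define d where "d i = (if i \<in> J then c i else 0)" for i
  have "(\<Sum>i\<in>J. \<Sum>j\<in>J. cnj (c i) * A i j * c j) = (\<Sum>i\<in>I. \<Sum>j\<in>I. cnj (d i) * A i j * d j)"
    using assms(1,3) unfolding d_def
    by (intro sum.mono_neutral_cong_left sum.mono_neutral_left) (auto intro!: sum.mono_neutral_cong_left)
  then show "(\<Sum>i\<in>J. \<Sum>j\<in>J. cnj (c i) * A i j * c j) \<in> \<real>\<^sub>\<ge>\<^sub>0"
    using assms(2) by (simp add: psd_matrix_def)
qed

text \<open>
  A family may repeat points and may have any finite index type; this is the form in which positivity
  is used, because it lets index sets be products and sums.
\<close>
lemma kernel_on_family:
  assumes K: "kernel_on X K" and "finite I" "\<And>i. i \<in> I \<Longrightarrow> z i \<in> X"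
  shows "psd_matrix I (\<lambda>i j. K (z i) (z j))"
  unfolding psd_matrix_def
proof
  fix c
  obtain h where h: "bij_betw h {..<card I} I"
    using \<open>finite I\<close> ex_bij_betw_nat_finite atLeast0LessThan by metis
  have "(\<Sum>i<card I. \<Sum>j<card I. cnj (c (h i)) * K (z (h i)) (z (h j)) * c (h j)) \<in> \<real>\<^sub>\<ge>\<^sub>0"
    using K assms(3) bij_betwE[OF h] unfolding kernel_on_def psd_matrix_def
    by (elim allE[of _ "card I"] allE[of _ "\<lambda>i. z (h i)"] impE allE[of _ "\<lambda>i. c (h i)"]) auto
  also have "(\<Sum>i<card I. \<Sum>j<card I. cnj (c (h i)) * K (z (h i)) (z (h j)) * c (h j)) =
      (\<Sum>i\<in>I. \<Sum>j\<in>I. cnj (c i) * K (z i) (z j) * c j)"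
    by (subst sum.reindex_bij_betw[OF h, symmetric], subst sum.reindex_bij_betw[OF h, symmetric]) simp
  finally show "(\<Sum>i\<in>I. \<Sum>j\<in>I. cnj (c i) * K (z i) (z j) * c j) \<in> \<real>\<^sub>\<ge>\<^sub>0" .
qed

text \<open>
  Only sets of distinct points have to be tested: the coefficients at equal points can be added up.
\<close>
lemma kernel_onI:
  assumes "\<And>A c. finite A \<Longrightarrow> A \<subseteq> X \<Longrightarrow>
      (\<Sum>x\<in>A. \<Sum>y\<in>A. cnj (c x) * K x y * c y) \<in> \<real>\<^sub>\<ge>\<^sub>0"
  shows "kernel_on X K"
  unfolding kernel_on_def psd_matrix_def
proof (intro allI impI)
  fix n :: nat and z and c :: "nat \<Rightarrow> complex"
  assume z: "\<forall>i<n. z i \<in> X"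
  define A where "A = z ` {..<n}"
  define C where "C x = (\<Sum>i\<in>{i\<in>{..<n}. z i = x}. c i)" for x
  have gen: "(\<Sum>i<n. F i) = (\<Sum>x\<in>A. \<Sum>i\<in>{i\<in>{..<n}. z i = x}. F i)" for F :: "nat \<Rightarrow> complex"
    unfolding A_def by (rule sum.image_gen) simp
  have "(\<Sum>i<n. \<Sum>j<n. cnj (c i) * K (z i) (z j) * c j) = (\<Sum>x\<in>A. \<Sum>y\<in>A. cnj (C x) * K x y * C y)"
  proof -
    have "(\<Sum>i\<in>{i\<in>{..<n}. z i = x}. \<Sum>j\<in>{j\<in>{..<n}. z j = y}. cnj (c i) * K (z i) (z j) * c j)
        = cnj (C x) * K x y * C y" for x y
      by (simp add: C_def sum_distrib_left sum_distrib_right)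
         (rule sum.swap)
    then show ?thesis
      by (simp only: gen) (simp only: sum.swap[of _ A "{i\<in>{..<n}. z i = _}"])
  qed
  moreover have "finite A" "A \<subseteq> X" using z by (auto simp: A_def)
  ultimately show "(\<Sum>i<n. \<Sum>j<n. cnj (c i) * K (z i) (z j) * c j) \<in> \<real>\<^sub>\<ge>\<^sub>0"
    using assms by simp
qed

lemma kernel_onD:
  assumes "kernel_on X K" "finite A" "A \<subseteq> X"
  shows "(\<Sum>x\<in>A. \<Sum>y\<in>A. cnj (c x) * K x y * c y) \<in> \<real>\<^sub>\<ge>\<^sub>0"
proof -
  have "psd_matrix A (\<lambda>x y. K x y)"
    using assms(3) by (intro kernel_on_family[OF assms(1,2)]) blast
  then show ?thesis unfolding psd_matrix_def by blast
qed

lemma kernel_on_finite_iff: "finite I \<Longrightarrow> kernel_on I A \<longleftrightarrow> psd_matrix I A"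
proof
  assume I: "finite I"
  show "psd_matrix I A" if "kernel_on I A"
    unfolding psd_matrix_def using kernel_onD[OF that I order_refl] by blast
  show "kernel_on I A" if "psd_matrix I A"
  proof (rule kernel_onI)
    fix B c assume "B \<subseteq> I"
    show "(\<Sum>x\<in>B. \<Sum>y\<in>B. cnj (c x) * A x y * c y) \<in> \<real>\<^sub>\<ge>\<^sub>0"
      using psd_matrix_restrict[OF I that \<open>B \<subseteq> I\<close>] unfolding psd_matrix_def by blast
  qed
qed

lemma kernel_on_pullback:
  assumes "kernel_on Y K" "\<And>x. x \<in> X \<Longrightarrow> \<phi> x \<in> Y"
  shows "kernel_on X (\<lambda>x y. K (\<phi> x) (\<phi> y))"
  unfolding kernel_on_def
proof (intro allI impI)
  fix n :: nat and z
  assume "\<forall>i<n. z i \<in> X"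
  then show "psd_matrix {..<n} (\<lambda>i j. K (\<phi> (z i)) (\<phi> (z j)))"
    by (intro kernel_on_family[OF assms(1)] assms(2)) auto
qed

lemma kernel_on_subset: "kernel_on Y K \<Longrightarrow> X \<subseteq> Y \<Longrightarrow> kernel_on X K"
  by (rule kernel_on_pullback[of Y K X "\<lambda>x. x"]) auto

lemma kernel_on_cong:
  assumes "kernel_on X K" "\<And>x y. x \<in> X \<Longrightarrow> y \<in> X \<Longrightarrow> K x y = L x y"
  shows "kernel_on X L"
proof (rule kernel_onI)
  fix A c assume A: "finite A" "A \<subseteq> X"
  have "cnj (c x) * K x y * c y = cnj (c x) * L x y * c y" if "x \<in> A" "y \<in> A" for x y
    using assms(2)[of x y] that A(2) by auto
  then have "(\<Sum>x\<in>A. \<Sum>y\<in>A. cnj (c x) * K x y * c y) = (\<Sum>x\<in>A. \<Sum>y\<in>A. cnj (c x) * L x y * c y)"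
    by (intro sum.cong refl)
  then show "(\<Sum>x\<in>A. \<Sum>y\<in>A. cnj (c x) * L x y * c y) \<in> \<real>\<^sub>\<ge>\<^sub>0"
    using kernel_onD[OF assms(1) A, of c] by (rule subst)
qed

lemma kernel_on_zero: "kernel_on X (\<lambda>x y. 0)"
  by (rule kernel_onI) simp

lemma kernel_on_add:
  assumes "kernel_on X K" "kernel_on X L"
  shows "kernel_on X (\<lambda>x y. K x y + L x y)"
proof (rule kernel_onI)
  fix A c assume A: "finite A" "A \<subseteq> X"
  show "(\<Sum>x\<in>A. \<Sum>y\<in>A. cnj (c x) * (K x y + L x y) * c y) \<in> \<real>\<^sub>\<ge>\<^sub>0"
    using nonneg_Reals_add_I[OF kernel_onD[OF assms(1) A, of c] kernel_onD[OF assms(2) A, of c]]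
    by (simp add: algebra_simps sum.distrib)
qed

lemma kernel_on_sum:
  "(\<And>t. t \<in> T \<Longrightarrow> kernel_on X (K t)) \<Longrightarrow> kernel_on X (\<lambda>x y. \<Sum>t\<in>T. K t x y)"
  by (induction T rule: infinite_finite_induct) (auto intro: kernel_on_zero kernel_on_add)

lemma kernel_on_conjugate:
  assumes "kernel_on X K"
  shows "kernel_on X (\<lambda>x y. f x * K x y * cnj (f y))"
proof (rule kernel_onI)
  fix A c assume A: "finite A" "A \<subseteq> X"
  show "(\<Sum>x\<in>A. \<Sum>y\<in>A. cnj (c x) * (f x * K x y * cnj (f y)) * c y) \<in> \<real>\<^sub>\<ge>\<^sub>0"
    using kernel_onD[OF assms A, of "\<lambda>x. cnj (f x) * c x"] by (simp add: mult_ac)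
qed

lemma kernel_on_one: "kernel_on X (\<lambda>x y. 1)"
proof (rule kernel_onI)
  fix A :: "'a set" and c :: "'a \<Rightarrow> complex"
  have "(\<Sum>x\<in>A. \<Sum>y\<in>A. cnj (c x) * 1 * c y) = cnj (sum c A) * sum c A"
    by (simp add: sum_product)
  also have "\<dots> = complex_of_real ((cmod (sum c A))\<^sup>2)"
    by (metis complex_norm_square mult.commute)
  finally show "(\<Sum>x\<in>A. \<Sum>y\<in>A. cnj (c x) * 1 * c y) \<in> \<real>\<^sub>\<ge>\<^sub>0" by simp
qed

lemma kernel_on_rank_one: "kernel_on X (\<lambda>x y. f x * cnj (f y))"
  using kernel_on_conjugate[OF kernel_on_one, of X f] by simp

lemma kernel_on_scale:
  assumes "kernel_on X K" "r \<in> \<real>\<^sub>\<ge>\<^sub>0"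
  shows "kernel_on X (\<lambda>x y. r * K x y)"
proof (rule kernel_onI)
  fix A c assume A: "finite A" "A \<subseteq> X"
  show "(\<Sum>x\<in>A. \<Sum>y\<in>A. cnj (c x) * (r * K x y) * c y) \<in> \<real>\<^sub>\<ge>\<^sub>0"
    using nonneg_Reals_mult_I[OF assms(2) kernel_onD[OF assms(1) A, of c]]
    by (simp add: sum_distrib_left mult_ac)
qed

lemma kernel_on_limit:
  assumes "\<And>n. kernel_on X (K n)"
    and "\<And>x y. x \<in> X \<Longrightarrow> y \<in> X \<Longrightarrow> (\<lambda>n. K n x y) \<longlonglongrightarrow> L x y"
  shows "kernel_on X L"
proof (rule kernel_onI)
  fix A c assume A: "finite A" "A \<subseteq> X"
  have "(\<lambda>n. \<Sum>x\<in>A. \<Sum>y\<in>A. cnj (c x) * K n x y * c y)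
      \<longlonglongrightarrow> (\<Sum>x\<in>A. \<Sum>y\<in>A. cnj (c x) * L x y * c y)"
    using A assms(2) by (intro tendsto_intros) auto
  then show "(\<Sum>x\<in>A. \<Sum>y\<in>A. cnj (c x) * L x y * c y) \<in> \<real>\<^sub>\<ge>\<^sub>0"
    by (rule closed_sequentially[OF closed_nonneg_Reals_complex kernel_onD[OF assms(1) A, of c]])
qed

text \<open>
  One more point with its own coefficient, which may coincide with a point of \<open>A\<close>.  Choosing the
  coefficient \<open>d\<close> well yields the symmetry, Cauchy-Schwarz and Schur complement facts below.
\<close>
lemma kernel_on_bordered:
  assumes K: "kernel_on X K" and A: "finite A" "A \<subseteq> X" and z: "z \<in> X"
  shows "(\<Sum>x\<in>A. \<Sum>y\<in>A. cnj (c x) * K x y * c y) + cnj d * (\<Sum>y\<in>A. K z y * c y)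
      + (\<Sum>x\<in>A. cnj (c x) * K x z) * d + cnj d * K z z * d \<in> \<real>\<^sub>\<ge>\<^sub>0"
proof -
  define I where "I = insert None (Some ` A)"
  define c' where "c' = case_option d c"
  have sm: "(\<Sum>i\<in>I. F i) = F None + (\<Sum>x\<in>A. F (Some x))" for F :: "'a option \<Rightarrow> complex"
    using A(1) unfolding I_def by (subst sum.insert) (auto simp: sum.reindex)
  have "psd_matrix I (\<lambda>i j. K (case_option z id i) (case_option z id j))"
    by (rule kernel_on_family[OF K]) (use A z in \<open>auto simp: I_def\<close>)
  then have "(\<Sum>i\<in>I. \<Sum>j\<in>I. cnj (c' i) * K (case_option z id i) (case_option z id j) * c' j) \<in> \<real>\<^sub>\<ge>\<^sub>0"
    by (simp add: psd_matrix_def)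
  then show ?thesis
    by (simp add: sm c'_def sum.distrib sum_distrib_left sum_distrib_right algebra_simps)
qed

lemma kernel_on_diag:
  assumes "kernel_on X K" "x \<in> X"
  shows "K x x \<in> \<real>\<^sub>\<ge>\<^sub>0"
  using kernel_onD[OF assms(1), of "{x}" "\<lambda>_. 1"] assms(2) by simp

lemma kernel_on_diag_real:
  assumes "kernel_on X K" "x \<in> X"
  shows "K x x = complex_of_real (Re (K x x))" "Re (K x x) \<ge> 0"
  using kernel_on_diag[OF assms] by (auto simp: complex_nonneg_Reals_iff complex_eq_iff)

lemma kernel_on_pair:
  assumes "kernel_on X K" "x \<in> X" "z \<in> X"
  shows "K x x + cnj d * K z x + K x z * d + cnj d * K z z * d \<in> \<real>\<^sub>\<ge>\<^sub>0"
  using kernel_on_bordered[OF assms(1), of "{x}" z "\<lambda>_. 1" d] assms(2,3) by simp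

lemma kernel_on_hermitian:
  assumes K: "kernel_on X K" and "x \<in> X" "z \<in> X"
  shows "K z x = cnj (K x z)"
proof -
  \<comment> \<open>With real diagonal entries, the forms with coefficients \<open>(1, 1)\<close> and \<open>(1, \<i>)\<close> are real only if the
    off-diagonal entries are conjugate.\<close>
  have d: "Im (K x x) = 0" "Im (K z z) = 0"
    using kernel_on_diag[OF K] assms(2,3) by (auto simp: complex_nonneg_Reals_iff)
  show ?thesis
    using kernel_on_pair[OF assms, of 1] kernel_on_pair[OF assms, of \<i>] d
    by (simp add: complex_nonneg_Reals_iff complex_eq_iff)
qed

lemma kernel_on_diag_zero:
  assumes K: "kernel_on X K" and "x \<in> X" "z \<in> X" "K z z = 0"
  shows "K x z = 0" "K z x = 0"
proof -
  define m where "m = (cmod (K x z))\<^sup>2"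
  have h: "K z x = cnj (K x z)" by (rule kernel_on_hermitian[OF K assms(2,3)])
  have "Re (K x x) - 2 * t * m \<ge> 0" for t :: real
    using kernel_on_pair[OF K assms(2,3), of "- complex_of_real t * cnj (K x z)"] assms(4)
    unfolding h m_def cmod_power2
    by (simp add: complex_nonneg_Reals_iff power2_eq_square algebra_simps)
  \<comment> \<open>An affine function of \<open>t\<close> that is bounded below on the whole line is constant.\<close>
  from this[of "(Re (K x x) + 1) / (2 * m)"] have "m = 0"
    by (cases "m = 0") (auto simp: field_simps)
  then show "K x z = 0" "K z x = 0" by (auto simp: m_def h)
qed

text \<open>
  The Schur complement of a positive matrix is positive: minimise the bordered quadratic form over the
  coefficient at \<open>z\<close>.
\<close>
lemma kernel_on_kernel_at:
  assumes K: "kernel_on X K" and z: "z \<in> X"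
  shows "kernel_on X (kernel_at K z)"
proof (cases "K z z = 0")
  case True
  then show ?thesis
    by (intro kernel_on_cong[OF K]) (simp add: kernel_at_def)
next
  case False
  have real: "cnj (K z z) = K z z"
    by (rule kernel_on_hermitian[OF K z z, symmetric])
  show ?thesis
  proof (rule kernel_onI)
    fix A c assume A: "finite A" "A \<subseteq> X"
    define S where "S = (\<Sum>y\<in>A. K z y * c y)"
    have S': "(\<Sum>x\<in>A. cnj (c x) * K x z) = cnj S"
      using A kernel_on_hermitian[OF K z]
      by (auto simp: S_def mult.commute intro!: sum.cong)
    have "(\<Sum>x\<in>A. \<Sum>y\<in>A. cnj (c x) * kernel_at K z x y * c y) =
        (\<Sum>x\<in>A. \<Sum>y\<in>A. cnj (c x) * K x y * c y) - (\<Sum>x\<in>A. cnj (c x) * K x z) * S / K z z"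
      unfolding S_def sum_product
      by (simp add: kernel_at_def algebra_simps sum_subtractf sum_divide_distrib)
    also have "\<dots> = (\<Sum>x\<in>A. \<Sum>y\<in>A. cnj (c x) * K x y * c y) + cnj (- S / K z z) * (\<Sum>y\<in>A. K z y * c y)
      + (\<Sum>x\<in>A. cnj (c x) * K x z) * (- S / K z z) + cnj (- S / K z z) * K z z * (- S / K z z)"
      using False unfolding S' S_def[symmetric] by (simp add: real field_simps)
    also have "\<dots> \<in> \<real>\<^sub>\<ge>\<^sub>0"
      by (rule kernel_on_bordered[OF K A z])
    finally show "(\<Sum>x\<in>A. \<Sum>y\<in>A. cnj (c x) * kernel_at K z x y * c y) \<in> \<real>\<^sub>\<ge>\<^sub>0" .
  qed
qed

lemma kernel_at_base:
  assumes "kernel_on X K" "x \<in> X" "z \<in> X"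
  shows "kernel_at K z x z = 0" "kernel_at K z z x = 0"
  using kernel_on_diag_zero[OF assms] by (auto simp: kernel_at_def)

lemma kernel_on_rank_one_at:
  assumes K: "kernel_on X K" and z: "z \<in> X"
  shows "kernel_on X (\<lambda>x y. K x z * K z y / K z z)"
proof -
  have "1 / K z z \<in> \<real>\<^sub>\<ge>\<^sub>0"
    using kernel_on_diag[OF K z] nonneg_Reals_divide_I[of 1] by simp
  from kernel_on_scale[OF kernel_on_rank_one this, of X "\<lambda>x. K x z"] show ?thesis
    by (rule kernel_on_cong) (use kernel_on_hermitian[OF K _ z] in simp)
qed

lemma kernel_on_cauchy_schwarz:
  assumes K: "kernel_on X K" and "x \<in> X" "z \<in> X"
  shows "(cmod (K x z))\<^sup>2 \<le> Re (K x x) * Re (K z z)"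
proof (cases "K z z = 0")
  case True
  then show ?thesis using kernel_on_diag_zero[OF assms] by simp
next
  case False
  define r where "r = Re (K z z)"
  have r: "K z z = complex_of_real r" "r > 0"
    using kernel_on_diag_real[OF K assms(3)] False by (auto simp: r_def order_le_less)
  have "K x z * K z x = complex_of_real ((cmod (K x z))\<^sup>2)"
    using kernel_on_hermitian[OF K assms(2,3)] by (simp only: complex_norm_square)
  then have "Re (kernel_at K z x x) = Re (K x x) - (cmod (K x z))\<^sup>2 / r"
    by (simp add: kernel_at_def r(1) flip: of_real_divide)
  moreover have "Re (kernel_at K z x x) \<ge> 0"
    by (rule kernel_on_diag_real(2)[OF kernel_on_kernel_at[OF K assms(3)] assms(2)])
  ultimately have "(cmod (K x z))\<^sup>2 / r \<le> Re (K x x)" by simp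
  then show ?thesis
    using r(2) unfolding r_def[symmetric] by (simp add: pos_divide_le_eq)
qed

text \<open>
  Cholesky factorization: split off the rank one part at one point, after which the kernel vanishes at
  that point, and continue with the remaining points.
\<close>
lemma kernel_on_factorization:
  assumes "finite A" "A \<subseteq> X" "kernel_on X K"
  shows "\<exists>b :: 'a \<Rightarrow> nat \<Rightarrow> complex. \<forall>x\<in>A. \<forall>y\<in>A. K x y = (\<Sum>t<card A. b x t * cnj (b y t))"
  using assms
proof (induction A arbitrary: K rule: finite_induct)
  case empty
  then show ?case by simp
next
  case (insert z A)
  then have z: "z \<in> X" and A: "A \<subseteq> X" by auto
  obtain b where b: "\<And>x y. x \<in> A \<Longrightarrow> y \<in> A \<Longrightarrow>
      kernel_at K z x y = (\<Sum>t<card A. b x t * cnj (b y t))"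
    using insert.IH[OF A kernel_on_kernel_at[OF insert.prems(2) z]] by blast
  define r where "r = Re (K z z)"
  have r: "K z z = complex_of_real r" "r \<ge> 0"
    using kernel_on_diag_real[OF insert.prems(2) z] by (auto simp: r_def)
  define b' where "b' x t = (if t = card A then K x z / complex_of_real (sqrt r)
      else if x = z then 0 else b x t)" for x t
  have e: "b' x (card A) * cnj (b' y (card A)) = K x z * K z y / K z z" if "x \<in> X" "y \<in> X" for x y
    using r kernel_on_hermitian[OF insert.prems(2) that(2) z]
    by (simp add: b'_def flip: of_real_mult)
  have "K x y = (\<Sum>t<card (insert z A). b' x t * cnj (b' y t))" if xy: "x \<in> insert z A" "y \<in> insert z A" for x y
  proof -
    have X: "x \<in> X" "y \<in> X" using xy insert.prems(1) by auto
    have "(\<Sum>t<card A. b' x t * cnj (b' y t)) = kernel_at K z x y"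
      using xy insert.hyps(2) kernel_at_base[OF insert.prems(2) X(1) z] kernel_at_base[OF insert.prems(2) X(2) z]
      by (cases "x = z"; cases "y = z") (auto simp: b'_def b intro!: sum.cong)
    with insert.hyps e[OF X] show ?thesis
      by (simp add: kernel_at_def)
  qed
  then show ?case by blast
qed

text \<open>
  Schur product theorem.  After factorizing \<open>K\<close> on a finite set, the product is a sum of
  conjugates of \<open>L\<close>.
\<close>
lemma kernel_on_mult:
  assumes K: "kernel_on X K" and L: "kernel_on X L"
  shows "kernel_on X (\<lambda>x y. K x y * L x y)"
proof (rule kernel_onI)
  fix A c assume A: "finite A" "A \<subseteq> X"
  obtain b :: "'a \<Rightarrow> nat \<Rightarrow> complex" where b: "\<And>x y. x \<in> A \<Longrightarrow> y \<in> A \<Longrightarrow> K x y = (\<Sum>t<card A. b x t * cnj (b y t))"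
    using kernel_on_factorization[OF A K] by blast
  have "kernel_on A (\<lambda>x y. \<Sum>t<card A. b x t * L x y * cnj (b y t))"
    by (intro kernel_on_sum kernel_on_conjugate kernel_on_subset[OF L A(2)])
  then have "kernel_on A (\<lambda>x y. K x y * L x y)"
    by (rule kernel_on_cong) (simp add: b sum_distrib_left mult_ac)
  then show "(\<Sum>x\<in>A. \<Sum>y\<in>A. cnj (c x) * (K x y * L x y) * c y) \<in> \<real>\<^sub>\<ge>\<^sub>0"
    by (rule kernel_onD) (use A in auto)
qed

lemma kernel_on_power: "kernel_on X K \<Longrightarrow> kernel_on X (\<lambda>x y. K x y ^ n)"
  by (induction n) (auto intro: kernel_on_one kernel_on_mult)

lemma kernel_on_norm_less_one:
  assumes p: "kernel_on X p" and d: "\<And>x. x \<in> X \<Longrightarrow> Re (p x x) < 1" and "x \<in> X" "y \<in> X"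
  shows "cmod (p x y) < 1"
proof -
  have "(cmod (p x y))\<^sup>2 \<le> Re (p x x) * Re (p y y)"
    by (rule kernel_on_cauchy_schwarz[OF p assms(3,4)])
  also have "\<dots> < 1"
    using d[OF assms(3)] d[OF assms(4)] kernel_on_diag_real(2)[OF p assms(3)] kernel_on_diag_real(2)[OF p assms(4)]
    by (metis less_eq_real_def mult_left_le order_le_less_trans)
  finally show ?thesis by (simp add: power_less_one_iff abs_square_less_1)
qed

lemma kernel_on_geometric:
  assumes p: "kernel_on X p" and d: "\<And>x. x \<in> X \<Longrightarrow> Re (p x x) < 1"
  shows "kernel_on X (\<lambda>x y. 1 / (1 - p x y))"
proof (rule kernel_on_limit)
  show "kernel_on X (\<lambda>x y. \<Sum>i<n. p x y ^ i)" for n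
    by (intro kernel_on_sum kernel_on_power p)
  show "(\<lambda>n. \<Sum>i<n. p x y ^ i) \<longlonglongrightarrow> 1 / (1 - p x y)" if "x \<in> X" "y \<in> X" for x y
    using geometric_sums[OF kernel_on_norm_less_one[OF p d that]] by (simp add: sums_def)
qed

section \<open>The Hilbert space of a kernel\<close>

definition finsupp :: "('a \<Rightarrow> complex) \<Rightarrow> bool" where
  "finsupp c \<longleftrightarrow> finite {x. c x \<noteq> 0}"

lemma finsupp_add: "finsupp c \<Longrightarrow> finsupp d \<Longrightarrow> finsupp (\<lambda>x. c x + d x)"
  unfolding finsupp_def by (rule finite_subset[of _ "{x. c x \<noteq> 0} \<union> {x. d x \<noteq> 0}"]) auto

lemma finsupp_scale: "finsupp c \<Longrightarrow> finsupp (\<lambda>x. t * c x)"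
  unfolding finsupp_def by (rule finite_subset[of _ "{x. c x \<noteq> 0}"]) auto

lemma finsupp_diff: "finsupp c \<Longrightarrow> finsupp d \<Longrightarrow> finsupp (\<lambda>x. c x - d x)"
  using finsupp_add[OF _ finsupp_scale[of d "-1"], of c] by simp

lemma finsupp_zero: "finsupp (\<lambda>x. 0)"
  by (simp add: finsupp_def)

lemma finsupp_sum: "(\<And>t. t \<in> T \<Longrightarrow> finsupp (c t)) \<Longrightarrow> finsupp (\<lambda>x. \<Sum>t\<in>T. c t x)"
  by (induction T rule: infinite_finite_induct) (auto intro: finsupp_zero finsupp_add)

lemma finsupp_mult: "finsupp c \<Longrightarrow> finsupp (\<lambda>x. t x * c x)"
  unfolding finsupp_def by (rule finite_subset[of _ "{x. c x \<noteq> 0}"]) auto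

text \<open>
  A finitely supported \<open>c\<close> stands for the combination of kernel functions with coefficients
  \<open>c\<close>; by the reproducing property its inner product with \<open>f\<close> has to be the following sum.
\<close>
definition pairing :: "('a \<Rightarrow> complex) \<Rightarrow> ('a \<Rightarrow> complex) \<Rightarrow> complex" where
  "pairing f c = (\<Sum>x | c x \<noteq> 0. cnj (c x) * f x)"

lemma pairing_eq: "finite A \<Longrightarrow> {x. c x \<noteq> 0} \<subseteq> A \<Longrightarrow> pairing f c = (\<Sum>x\<in>A. cnj (c x) * f x)"
  unfolding pairing_def by (rule sum.mono_neutral_left) auto

lemma pairing_add_left: "pairing (\<lambda>x. f x + g x) c = pairing f c + pairing g c"
  by (simp add: pairing_def algebra_simps sum.distrib)

lemma pairing_diff_left: "pairing (\<lambda>x. f x - g x) c = pairing f c - pairing g c"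
  by (simp add: pairing_def algebra_simps sum_subtractf)

lemma pairing_scale_left: "pairing (\<lambda>x. t * f x) c = t * pairing f c"
  by (simp add: pairing_def sum_distrib_left mult_ac)

lemma pairing_add_right:
  assumes "finsupp c" "finsupp d"
  shows "pairing f (\<lambda>x. c x + d x) = pairing f c + pairing f d"
proof -
  let ?A = "{x. c x \<noteq> 0} \<union> {x. d x \<noteq> 0}"
  have "finite ?A" using assms by (simp add: finsupp_def)
  then show ?thesis
    by (subst (1 2 3) pairing_eq[of ?A]) (auto simp: algebra_simps sum.distrib)
qed

lemma pairing_scale_right:
  assumes "finsupp c"
  shows "pairing f (\<lambda>x. t * c x) = cnj t * pairing f c"
proof -
  have "finite {x. c x \<noteq> 0}" using assms by (simp add: finsupp_def)
  then show ?thesis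
    by (subst (1 2) pairing_eq[of "{x. c x \<noteq> 0}"]) (auto simp: sum_distrib_left mult_ac)
qed

lemma pairing_diff_right:
  assumes "finsupp c" "finsupp d"
  shows "pairing f (\<lambda>x. c x - d x) = pairing f c - pairing f d"
  using pairing_add_right[OF assms(1) finsupp_scale[OF assms(2), of "-1"]]
    pairing_scale_right[OF assms(2), of f "-1"] by simp

lemma pairing_zero_right: "pairing f (\<lambda>x. 0) = 0"
  by (simp add: pairing_def)

lemma pairing_tendsto:
  assumes "\<And>x. (\<lambda>n. F n x) \<longlonglongrightarrow> f x"
  shows "(\<lambda>n. pairing (F n) c) \<longlonglongrightarrow> pairing f c"
  unfolding pairing_def by (intro tendsto_intros assms)

lemma square_tendsto_zero:
  fixes a :: "nat \<Rightarrow> complex"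
  assumes "\<And>n. (cmod (a n))\<^sup>2 \<le> r n" "r \<longlonglongrightarrow> 0"
  shows "a \<longlonglongrightarrow> 0"
proof -
  have "(\<lambda>n. (cmod (a n))\<^sup>2) \<longlonglongrightarrow> 0"
    by (rule tendsto_sandwich[OF _ _ tendsto_const assms(2)]) (auto simp: assms(1))
  then have "(\<lambda>n. sqrt ((cmod (a n))\<^sup>2)) \<longlonglongrightarrow> sqrt 0" by (rule tendsto_real_sqrt)
  then show ?thesis by (simp add: tendsto_norm_zero_iff)
qed

text \<open>
  The kernel is taken on a whole type, so that coefficient functions carry no side condition; a kernel
  on a subset is extended by zero, which makes all functions in its space vanish outside the subset.

  In a Hilbert space, \<open>\<parallel>f\<parallel>\<^sup>2\<close> is the supremum of \<open>2 Re \<langle>f,c\<rangle> - \<parallel>c\<parallel>\<^sup>2\<close> over the vectors \<open>c\<close> of any dense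
  subspace.  Here this formula is the definition of the norm, and the space consists of the functions
  for which the supremum is finite.  Completeness and the norm estimates for multipliers
  then come directly from the supremum, and only the inner product needs approximation by kernel
  combinations.
\<close>
locale full_kernel =
  fixes s :: "'a \<Rightarrow> 'a \<Rightarrow> complex"
  assumes kernel: "kernel_on UNIV s"
begin

definition kernel_comb :: "('a \<Rightarrow> complex) \<Rightarrow> 'a \<Rightarrow> complex" where
  "kernel_comb c x = (\<Sum>y | c y \<noteq> 0. s x y * c y)"

definition energy :: "('a \<Rightarrow> complex) \<Rightarrow> real" where
  "energy c = Re (pairing (kernel_comb c) c)"

definition dual_form :: "('a \<Rightarrow> complex) \<Rightarrow> ('a \<Rightarrow> complex) \<Rightarrow> real" where
  "dual_form f c = 2 * Re (pairing f c) - energy c"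

definition rk_space :: "('a \<Rightarrow> complex) set" where
  "rk_space = {f. bdd_above (dual_form f ` Collect finsupp)}"

definition sqnorm :: "('a \<Rightarrow> complex) \<Rightarrow> real" where
  "sqnorm f = (SUP c\<in>Collect finsupp. dual_form f c)"

lemma hermitian: "s y x = cnj (s x y)"
  by (rule kernel_on_hermitian[OF kernel]) auto

lemma comb_eq_pairing: "kernel_comb c x = cnj (pairing (\<lambda>y. s y x) c)"
  by (simp add: kernel_comb_def pairing_def mult.commute) (simp add: hermitian[of x])

lemma comb_add: "finsupp c \<Longrightarrow> finsupp d \<Longrightarrow> kernel_comb (\<lambda>x. c x + d x) = (\<lambda>x. kernel_comb c x + kernel_comb d x)"
  by (simp add: comb_eq_pairing fun_eq_iff pairing_add_right)

lemma comb_diff: "finsupp c \<Longrightarrow> finsupp d \<Longrightarrow> kernel_comb (\<lambda>x. c x - d x) = (\<lambda>x. kernel_comb c x - kernel_comb d x)"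
  by (simp add: comb_eq_pairing fun_eq_iff pairing_diff_right)

lemma comb_scale: "finsupp c \<Longrightarrow> kernel_comb (\<lambda>x. t * c x) = (\<lambda>x. t * kernel_comb c x)"
  by (simp add: comb_eq_pairing fun_eq_iff pairing_scale_right)

lemma pairing_comb: "pairing (kernel_comb c) d = (\<Sum>x | d x \<noteq> 0. \<Sum>y | c y \<noteq> 0. cnj (d x) * s x y * c y)"
  by (simp add: pairing_def kernel_comb_def sum_distrib_left mult_ac)

lemma pairing_comb_sym: "pairing (kernel_comb c) d = cnj (pairing (kernel_comb d) c)"
  by (subst (1 2) pairing_comb, subst sum.swap, simp)
     (intro sum.cong refl, subst hermitian, simp add: mult_ac)

lemma pairing_comb_self:
  assumes "finsupp c"
  shows "pairing (kernel_comb c) c = complex_of_real (energy c)" "energy c \<ge> 0"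
proof -
  have "pairing (kernel_comb c) c \<in> \<real>\<^sub>\<ge>\<^sub>0"
    using kernel_onD[OF kernel, of "{x. c x \<noteq> 0}" c] assms by (simp add: pairing_comb finsupp_def)
  then show "pairing (kernel_comb c) c = complex_of_real (energy c)" "energy c \<ge> 0"
    by (auto simp: energy_def complex_nonneg_Reals_iff complex_eq_iff)
qed

lemma energy_eq_sum:
  assumes "finite A" "{x. c x \<noteq> 0} \<subseteq> A"
  shows "complex_of_real (energy c) = (\<Sum>x\<in>A. \<Sum>y\<in>A. cnj (c x) * s x y * c y)"
proof -
  have e: "kernel_comb c x = (\<Sum>y\<in>A. s x y * c y)" for x
    unfolding kernel_comb_def using assms by (intro sum.mono_neutral_left) auto
  have "finsupp c" using assms finite_subset by (auto simp: finsupp_def)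
  from pairing_comb_self(1)[OF this] pairing_eq[OF assms, of "kernel_comb c"] show ?thesis
    by (simp add: e sum_distrib_left mult_ac)
qed

lemma energy_add:
  assumes "finsupp c" "finsupp d"
  shows "energy (\<lambda>x. c x + d x) = energy c + 2 * Re (pairing (kernel_comb d) c) + energy d"
  using pairing_comb_sym[of c d]
  by (simp add: energy_def comb_add[OF assms] pairing_add_right[OF assms] pairing_add_left)

lemma energy_scale:
  assumes "finsupp c"
  shows "energy (\<lambda>x. t * c x) = (cmod t)\<^sup>2 * energy c"
proof -
  have "pairing (kernel_comb (\<lambda>x. t * c x)) (\<lambda>x. t * c x) = (t * cnj t) * pairing (kernel_comb c) c"
    by (simp add: comb_scale[OF assms] pairing_scale_right[OF assms] pairing_scale_left)
  also have "\<dots> = complex_of_real ((cmod t)\<^sup>2 * energy c)"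
    unfolding pairing_comb_self(1)[OF assms] complex_norm_square[symmetric] by simp
  finally show ?thesis
    by (simp only: energy_def[of "\<lambda>x. t * c x"] Re_complex_of_real)
qed

lemma energy_zero: "energy (\<lambda>x. 0) = 0"
  by (simp add: energy_def pairing_zero_right)

lemma dual_form_le_sqnorm: "f \<in> rk_space \<Longrightarrow> finsupp c \<Longrightarrow> dual_form f c \<le> sqnorm f"
  unfolding rk_space_def sqnorm_def by (intro cSUP_upper) auto

lemma sqnorm_le: "(\<And>c. finsupp c \<Longrightarrow> dual_form f c \<le> M) \<Longrightarrow> f \<in> rk_space \<and> sqnorm f \<le> M"
  unfolding rk_space_def sqnorm_def using finsupp_zero by (auto intro!: cSUP_least bdd_aboveI2)

lemma sqnorm_nonneg: "f \<in> rk_space \<Longrightarrow> sqnorm f \<ge> 0"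
  using dual_form_le_sqnorm[OF _ finsupp_zero, of f] by (simp add: dual_form_def pairing_zero_right energy_zero)

lemma dual_form_scale:
  "finsupp c \<Longrightarrow> dual_form f (\<lambda>x. t * c x) = 2 * Re (cnj t * pairing f c) - (cmod t)\<^sup>2 * energy c"
  by (simp add: dual_form_def pairing_scale_right energy_scale)

text \<open>
  Cauchy-Schwarz, obtained from the supremum at the optimal multiple of \<open>c\<close>.
\<close>
lemma pairing_bound:
  assumes "f \<in> rk_space" "finsupp c"
  shows "(cmod (pairing f c))\<^sup>2 \<le> sqnorm f * energy c"
proof -
  define m where "m = (cmod (pairing f c))\<^sup>2"
  have e: "energy c \<ge> 0" by (rule pairing_comb_self(2)[OF assms(2)])
  have b: "2 * r * m - r\<^sup>2 * m * energy c \<le> sqnorm f" for r :: real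
  proof -
    define t where "t = complex_of_real r * pairing f c"
    have "cnj t * pairing f c = complex_of_real (r * m)"
      unfolding t_def m_def of_real_mult complex_norm_square by simp
    moreover have "(cmod t)\<^sup>2 = r\<^sup>2 * m"
      by (simp add: t_def m_def norm_mult power_mult_distrib)
    ultimately show ?thesis
      using dual_form_le_sqnorm[OF assms(1) finsupp_scale[OF assms(2), of t]]
      by (simp add: dual_form_scale[OF assms(2)])
  qed
  show ?thesis
  proof (cases "energy c = 0")
    case True
    have "m = 0"
    proof (rule ccontr)
      assume "m \<noteq> 0"
      then have "2 * ((sqnorm f + 1) / (2 * m)) * m = sqnorm f + 1" by simp
      with b[of "(sqnorm f + 1) / (2 * m)"] show False by (simp add: True)
    qed
    then show ?thesis by (simp add: m_def[symmetric] True)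
  next
    case False
    then have "m / energy c \<le> sqnorm f"
      using b[of "1 / energy c"] by (simp add: power2_eq_square)
    then show ?thesis
      using False e by (simp add: m_def[symmetric] pos_divide_le_eq)
  qed
qed

lemma add_rk_space:
  assumes "f \<in> rk_space" "g \<in> rk_space"
  shows "(\<lambda>x. f x + g x) \<in> rk_space \<and> sqnorm (\<lambda>x. f x + g x) \<le> 2 * sqnorm f + 2 * sqnorm g"
proof (rule sqnorm_le)
  fix c :: "'a \<Rightarrow> complex" assume c: "finsupp c"
  have "dual_form (\<lambda>x. f x + g x) c = 2 * dual_form f (\<lambda>x. (1/2) * c x) + 2 * dual_form g (\<lambda>x. (1/2) * c x)"
    unfolding dual_form_scale[OF c] by (simp add: dual_form_def pairing_add_left power2_eq_square)
  also have "\<dots> \<le> 2 * sqnorm f + 2 * sqnorm g"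
    by (intro add_mono mult_left_mono dual_form_le_sqnorm assms finsupp_scale c) auto
  finally show "dual_form (\<lambda>x. f x + g x) c \<le> 2 * sqnorm f + 2 * sqnorm g" .
qed

lemma scale_rk_space:
  assumes "f \<in> rk_space"
  shows "(\<lambda>x. t * f x) \<in> rk_space \<and> sqnorm (\<lambda>x. t * f x) \<le> (cmod t)\<^sup>2 * sqnorm f"
proof (rule sqnorm_le)
  fix c :: "'a \<Rightarrow> complex" assume c: "finsupp c"
  define u where "u = cmod t * cmod (pairing f c)"
  have e: "energy c \<ge> 0" by (rule pairing_comb_self(2)[OF c])
  have q: "(cmod t)\<^sup>2 * sqnorm f \<ge> 0" using sqnorm_nonneg[OF assms] by simp
  have "(2 * u)\<^sup>2 \<le> 4 * ((cmod t)\<^sup>2 * sqnorm f * energy c)"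
    using mult_left_mono[OF pairing_bound[OF assms c], of "(cmod t)\<^sup>2"]
    by (simp add: u_def power_mult_distrib mult.assoc)
  also have "\<dots> \<le> ((cmod t)\<^sup>2 * sqnorm f + energy c)\<^sup>2"
    using zero_le_power2[of "(cmod t)\<^sup>2 * sqnorm f - energy c"] by (simp add: power2_diff power2_sum mult_ac)
  finally have "2 * u \<le> (cmod t)\<^sup>2 * sqnorm f + energy c"
    using q e by (auto intro: power2_le_imp_le)
  moreover have "Re (t * pairing f c) \<le> u"
    unfolding u_def norm_mult[symmetric] by (rule complex_Re_le_cmod)
  ultimately show "dual_form (\<lambda>x. t * f x) c \<le> (cmod t)\<^sup>2 * sqnorm f"
    by (simp add: dual_form_def pairing_scale_left)
qed

lemma diff_rk_space:
  assumes "f \<in> rk_space" "g \<in> rk_space"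
  shows "(\<lambda>x. f x - g x) \<in> rk_space \<and> sqnorm (\<lambda>x. f x - g x) \<le> 2 * sqnorm f + 2 * sqnorm g"
  using add_rk_space[OF assms(1) conjunct1[OF scale_rk_space[OF assms(2), of "-1"]]] scale_rk_space[OF assms(2), of "-1"]
  by simp

lemma zero_rk_space: "(\<lambda>x. 0) \<in> rk_space" "sqnorm (\<lambda>x. 0) = 0"
proof -
  have "dual_form (\<lambda>x. 0) c \<le> 0" if "finsupp c" for c
    using pairing_comb_self(2)[OF that] by (simp add: dual_form_def pairing_def)
  then have *: "(\<lambda>x. 0) \<in> rk_space \<and> sqnorm (\<lambda>x. 0) \<le> 0" by (rule sqnorm_le)
  then show "(\<lambda>x. 0) \<in> rk_space" "sqnorm (\<lambda>x. 0) = 0" using sqnorm_nonneg by force+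
qed

text \<open>
  Completing the square.  As a consequence, a combination \<open>d\<close> that nearly attains the supremum for
  \<open>f\<close> is close to \<open>f\<close> in norm, which is how kernel combinations are seen to be dense.
\<close>
lemma dual_form_diff_comb:
  assumes "finsupp c" "finsupp d"
  shows "dual_form (\<lambda>x. f x - kernel_comb d x) c = dual_form f (\<lambda>x. c x + d x) - dual_form f d"
  by (simp add: dual_form_def pairing_diff_left pairing_add_right[OF assms] energy_add[OF assms])

lemma sqnorm_diff_comb:
  assumes "f \<in> rk_space" "finsupp d"
  shows "(\<lambda>x. f x - kernel_comb d x) \<in> rk_space \<and> sqnorm (\<lambda>x. f x - kernel_comb d x) \<le> sqnorm f - dual_form f d"
proof (rule sqnorm_le)
  fix c :: "'a \<Rightarrow> complex" assume c: "finsupp c"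
  show "dual_form (\<lambda>x. f x - kernel_comb d x) c \<le> sqnorm f - dual_form f d"
    using dual_form_le_sqnorm[OF assms(1) finsupp_add[OF c assms(2)]] by (simp add: dual_form_diff_comb[OF c assms(2)])
qed

lemma comb_rk_space:
  assumes "finsupp d"
  shows "kernel_comb d \<in> rk_space" "energy d \<le> sqnorm (kernel_comb d)"
proof -
  have "(\<lambda>x. 0 - kernel_comb d x) \<in> rk_space"
    using sqnorm_diff_comb[OF zero_rk_space(1) assms] by blast
  from conjunct1[OF scale_rk_space[OF this, of "-1"]] show *: "kernel_comb d \<in> rk_space" by simp
  show "energy d \<le> sqnorm (kernel_comb d)"
    using dual_form_le_sqnorm[OF * assms] by (simp add: dual_form_def energy_def)
qed

definition approximates :: "(nat \<Rightarrow> 'a \<Rightarrow> complex) \<Rightarrow> ('a \<Rightarrow> complex) \<Rightarrow> bool" where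
  "approximates d g \<longleftrightarrow> (\<forall>n. finsupp (d n)) \<and> (\<lambda>n. sqnorm (\<lambda>x. g x - kernel_comb (d n) x)) \<longlonglongrightarrow> 0"

lemma approximates_exists:
  assumes "g \<in> rk_space"
  shows "\<exists>d. approximates d g"
proof -
  have "\<exists>c. finsupp c \<and> sqnorm g - inverse (Suc n) < dual_form g c" for n :: nat
  proof -
    have "\<exists>c\<in>Collect finsupp. sqnorm g - inverse (Suc n) < dual_form g c"
      unfolding sqnorm_def using assms finsupp_zero
      by (intro less_cSUP_iff[THEN iffD1]) (auto simp: rk_space_def)
    then show ?thesis by auto
  qed
  then obtain d where d: "\<And>n. finsupp (d n)" "\<And>n. sqnorm g - inverse (Suc n) < dual_form g (d n)"
    by metis
  have "(\<lambda>n. sqnorm (\<lambda>x. g x - kernel_comb (d n) x)) \<longlonglongrightarrow> 0"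
  proof (rule tendsto_sandwich[OF _ _ tendsto_const LIMSEQ_inverse_real_of_nat])
    show "\<forall>\<^sub>F n in sequentially. 0 \<le> sqnorm (\<lambda>x. g x - kernel_comb (d n) x)"
      using sqnorm_diff_comb[OF assms d(1)] sqnorm_nonneg by auto
    show "\<forall>\<^sub>F n in sequentially. sqnorm (\<lambda>x. g x - kernel_comb (d n) x) \<le> inverse (real (Suc n))"
      using sqnorm_diff_comb[OF assms d(1)] d(2) by (intro always_eventually allI) (smt (verit))
  qed
  with d(1) show ?thesis by (auto simp: approximates_def)
qed

lemma energy_diff_le:
  assumes "f \<in> rk_space" "finsupp c" "finsupp d"
  shows "energy (\<lambda>x. c x - d x) \<le> 2 * sqnorm (\<lambda>x. f x - kernel_comb c x) + 2 * sqnorm (\<lambda>x. f x - kernel_comb d x)"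
proof -
  have "kernel_comb (\<lambda>x. c x - d x) = (\<lambda>x. (f x - kernel_comb d x) - (f x - kernel_comb c x))"
    by (simp add: comb_diff[OF assms(2,3)])
  then have "sqnorm (kernel_comb (\<lambda>x. c x - d x)) \<le> 2 * sqnorm (\<lambda>x. f x - kernel_comb d x) + 2 * sqnorm (\<lambda>x. f x - kernel_comb c x)"
    using diff_rk_space[OF conjunct1[OF sqnorm_diff_comb[OF assms(1,3)]] conjunct1[OF sqnorm_diff_comb[OF assms(1,2)]]]
    by simp
  with comb_rk_space(2)[OF finsupp_diff[OF assms(2,3)]] show ?thesis by simp
qed

lemma pairing_approx_Cauchy:
  assumes f: "f \<in> rk_space" and g: "g \<in> rk_space" and d: "approximates d g"
  shows "convergent (\<lambda>n. pairing f (d n))"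
proof -
  have fs: "finsupp (d n)" for n using d by (simp add: approximates_def)
  define q where "q n = sqnorm (\<lambda>x. g x - kernel_comb (d n) x)" for n
  have q: "q \<longlonglongrightarrow> 0" using d by (simp add: approximates_def q_def[abs_def])
  have b: "(cmod (pairing f (d m) - pairing f (d n)))\<^sup>2 \<le> sqnorm f * (2 * q m + 2 * q n)" for m n
  proof -
    have "(cmod (pairing f (d m) - pairing f (d n)))\<^sup>2 \<le> sqnorm f * energy (\<lambda>x. d m x - d n x)"
      unfolding pairing_diff_right[OF fs fs, symmetric] by (rule pairing_bound[OF f finsupp_diff[OF fs fs]])
    also have "\<dots> \<le> sqnorm f * (2 * q m + 2 * q n)"
      unfolding q_def by (rule mult_left_mono[OF energy_diff_le[OF g fs fs] sqnorm_nonneg[OF f]])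
    finally show ?thesis .
  qed
  have "Cauchy (\<lambda>n. pairing f (d n))"
  proof (rule CauchyI)
    fix e :: real assume e: "e > 0"
    define \<delta> where "\<delta> = e\<^sup>2 / (4 * (sqnorm f + 1))"
    have "\<delta> > 0" using e sqnorm_nonneg[OF f] by (simp add: \<delta>_def)
    then obtain M where M: "\<And>n. n \<ge> M \<Longrightarrow> norm (q n - 0) < \<delta>"
      using LIMSEQ_D[OF q] by blast
    have "norm (pairing f (d m) - pairing f (d n)) < e" if "m \<ge> M" "n \<ge> M" for m n
    proof -
      have "2 * q m + 2 * q n \<le> 4 * \<delta>" using M[OF that(1)] M[OF that(2)] by (simp add: abs_less_iff)
      then have "sqnorm f * (2 * q m + 2 * q n) \<le> sqnorm f * (4 * \<delta>)"
        by (rule mult_left_mono[OF _ sqnorm_nonneg[OF f]])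
      also have "\<dots> < (sqnorm f + 1) * (4 * \<delta>)" using \<open>\<delta> > 0\<close> by simp
      also have "\<dots> = e\<^sup>2"
      proof -
        have "sqnorm f + 1 \<noteq> 0" using sqnorm_nonneg[OF f] by linarith
        then show ?thesis unfolding \<delta>_def by (simp only: times_divide_eq_right) (simp add: field_simps)
      qed
      finally have "(cmod (pairing f (d m) - pairing f (d n)))\<^sup>2 < e\<^sup>2" using b[of m n] by simp
      then show ?thesis using e by (simp add: power_less_imp_less_base)
    qed
    then show "\<exists>M. \<forall>m\<ge>M. \<forall>n\<ge>M. norm (pairing f (d m) - pairing f (d n)) < e" by blast
  qed
  then show ?thesis by (simp add: Cauchy_convergent_iff)
qed

definition approx :: "('a \<Rightarrow> complex) \<Rightarrow> nat \<Rightarrow> 'a \<Rightarrow> complex" where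
  "approx g = (SOME d. approximates d g)"

lemma approx: "g \<in> rk_space \<Longrightarrow> approximates (approx g) g"
  unfolding approx_def using approximates_exists by (rule someI_ex)

text \<open>
  Linear in \<open>f\<close> from the definition; symmetry is the part that needs proof.
\<close>
definition ip :: "('a \<Rightarrow> complex) \<Rightarrow> ('a \<Rightarrow> complex) \<Rightarrow> complex" where
  "ip f g = lim (\<lambda>n. pairing f (approx g n))"

text \<open>
  The limit does not depend on the approximating sequence, as two such sequences differ by combinations
  of small energy.
\<close>
lemma ip_lim:
  assumes f: "f \<in> rk_space" and g: "g \<in> rk_space" and d: "approximates d g"
  shows "(\<lambda>n. pairing f (d n)) \<longlonglongrightarrow> ip f g"
proof -
  let ?a = "approx g"
  have fs: "finsupp (d n)" "finsupp (?a n)" for n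
    using d approx[OF g] by (auto simp: approximates_def)
  have 1: "(\<lambda>n. pairing f (?a n)) \<longlonglongrightarrow> ip f g"
    unfolding ip_def using pairing_approx_Cauchy[OF f g approx[OF g]] by (simp add: convergent_LIMSEQ_iff)
  have "(\<lambda>n. pairing f (d n) - pairing f (?a n)) \<longlonglongrightarrow> 0"
  proof (rule square_tendsto_zero)
    fix n
    have "(cmod (pairing f (d n) - pairing f (?a n)))\<^sup>2 \<le> sqnorm f * energy (\<lambda>x. d n x - ?a n x)"
      unfolding pairing_diff_right[OF fs, symmetric] by (rule pairing_bound[OF f finsupp_diff[OF fs]])
    also have "\<dots> \<le> sqnorm f * (2 * sqnorm (\<lambda>x. g x - kernel_comb (d n) x) + 2 * sqnorm (\<lambda>x. g x - kernel_comb (?a n) x))"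
      by (rule mult_left_mono[OF energy_diff_le[OF g fs] sqnorm_nonneg[OF f]])
    finally show "(cmod (pairing f (d n) - pairing f (?a n)))\<^sup>2
        \<le> sqnorm f * (2 * sqnorm (\<lambda>x. g x - kernel_comb (d n) x) + 2 * sqnorm (\<lambda>x. g x - kernel_comb (?a n) x))" .
  next
    have "(\<lambda>n. sqnorm f * (2 * sqnorm (\<lambda>x. g x - kernel_comb (d n) x) + 2 * sqnorm (\<lambda>x. g x - kernel_comb (?a n) x)))
        \<longlonglongrightarrow> sqnorm f * (2 * 0 + 2 * 0)"
      using d approx[OF g] by (intro tendsto_intros) (auto simp: approximates_def)
    then show "(\<lambda>n. sqnorm f * (2 * sqnorm (\<lambda>x. g x - kernel_comb (d n) x) + 2 * sqnorm (\<lambda>x. g x - kernel_comb (?a n) x))) \<longlonglongrightarrow> 0"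
      by simp
  qed
  from tendsto_add[OF this 1] show ?thesis by simp
qed

lemma approximates_energy_bounded:
  assumes g: "g \<in> rk_space" and d: "approximates d g"
  shows "\<exists>B. \<forall>n. energy (d n) \<le> B"
proof -
  have fs: "finsupp (d n)" for n using d by (simp add: approximates_def)
  have "Bseq (\<lambda>n. sqnorm (\<lambda>x. g x - kernel_comb (d n) x))"
    using d by (intro convergent_imp_Bseq) (auto simp: approximates_def convergent_def)
  then obtain B where B: "\<And>n. norm (sqnorm (\<lambda>x. g x - kernel_comb (d n) x)) \<le> B" by (auto simp: Bseq_def)
  have "energy (d n) \<le> 2 * sqnorm g + 2 * B" for n
  proof -
    have "energy (d n) \<le> 2 * sqnorm (\<lambda>x. g x - kernel_comb (d n) x) + 2 * sqnorm g"
      using energy_diff_le[OF g fs[of n] finsupp_zero] by (simp add: kernel_comb_def[of "\<lambda>x. 0"])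
    with B[of n] show ?thesis by simp
  qed
  then show ?thesis by blast
qed

lemma ip_lim_comb:
  assumes f: "f \<in> rk_space" and g: "g \<in> rk_space" and e: "approximates e f" and d: "approximates d g"
  shows "(\<lambda>n. pairing (kernel_comb (e n)) (d n)) \<longlonglongrightarrow> ip f g"
proof -
  have fs: "finsupp (d n)" "finsupp (e n)" for n
    using d e by (auto simp: approximates_def)
  obtain B where B: "\<And>n. energy (d n) \<le> B" using approximates_energy_bounded[OF g d] by blast
  have "(\<lambda>n. pairing (\<lambda>x. f x - kernel_comb (e n) x) (d n)) \<longlonglongrightarrow> 0"
  proof (rule square_tendsto_zero)
    fix n
    have H: "(\<lambda>x. f x - kernel_comb (e n) x) \<in> rk_space" using sqnorm_diff_comb[OF f fs(2)] by blast
    show "(cmod (pairing (\<lambda>x. f x - kernel_comb (e n) x) (d n)))\<^sup>2 \<le> sqnorm (\<lambda>x. f x - kernel_comb (e n) x) * B"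
      using pairing_bound[OF H fs(1)] mult_left_mono[OF B sqnorm_nonneg[OF H]] by (rule order_trans)
  next
    show "(\<lambda>n. sqnorm (\<lambda>x. f x - kernel_comb (e n) x) * B) \<longlonglongrightarrow> 0"
      using e by (auto simp: approximates_def intro: tendsto_mult_left_zero)
  qed
  from tendsto_diff[OF ip_lim[OF f g d] this] show ?thesis by (simp add: pairing_diff_left)
qed

lemma ip_sym:
  assumes f: "f \<in> rk_space" and g: "g \<in> rk_space"
  shows "ip g f = cnj (ip f g)"
proof (rule LIMSEQ_unique)
  show "(\<lambda>n. pairing (kernel_comb (approx g n)) (approx f n)) \<longlonglongrightarrow> ip g f"
    by (rule ip_lim_comb[OF g f approx[OF g] approx[OF f]])
  show "(\<lambda>n. pairing (kernel_comb (approx g n)) (approx f n)) \<longlonglongrightarrow> cnj (ip f g)"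
    using tendsto_cnj[OF ip_lim_comb[OF f g approx[OF f] approx[OF g]]]
    by (simp flip: pairing_comb_sym)
qed

text \<open>
  The energies of the approximating combinations converge to \<open>ip f f\<close>, while
  \<open>2 Re \<langle>f,d\<rangle> - \<parallel>d\<parallel>\<^sup>2\<close> converges both to the supremum and to \<open>2 Re (ip f f) - Re (ip f f)\<close>.
\<close>
lemma ip_self:
  assumes f: "f \<in> rk_space"
  shows "ip f f = complex_of_real (sqnorm f)"
proof -
  let ?d = "approx f"
  have fs: "finsupp (?d n)" for n using approx[OF f] by (simp add: approximates_def)
  have "(\<lambda>n. complex_of_real (energy (?d n))) \<longlonglongrightarrow> ip f f"
    using ip_lim_comb[OF f f approx[OF f] approx[OF f]] by (simp add: pairing_comb_self(1)[OF fs])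
  then have e: "(\<lambda>n. energy (?d n)) \<longlonglongrightarrow> Re (ip f f)" and im: "Im (ip f f) = 0"
    using tendsto_Re tendsto_Im LIMSEQ_unique[OF tendsto_const[of 0]]
    by (fastforce, fastforce)
  have "(\<lambda>n. dual_form f (?d n)) \<longlonglongrightarrow> 2 * Re (ip f f) - Re (ip f f)"
    unfolding dual_form_def by (intro tendsto_intros e ip_lim[OF f f approx[OF f]])
  moreover have "(\<lambda>n. dual_form f (?d n)) \<longlonglongrightarrow> sqnorm f"
  proof (rule tendsto_sandwich)
    show "\<forall>\<^sub>F n in sequentially. dual_form f (?d n) \<le> sqnorm f"
      using dual_form_le_sqnorm[OF f fs] by simp
    show "\<forall>\<^sub>F n in sequentially. sqnorm f - sqnorm (\<lambda>x. f x - kernel_comb (?d n) x) \<le> dual_form f (?d n)"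
    proof (intro always_eventually allI)
      fix n
      have H: "(\<lambda>x. f x - kernel_comb (?d n) x) \<in> rk_space" using sqnorm_diff_comb[OF f fs] by blast
      have "dual_form f c \<le> sqnorm (\<lambda>x. f x - kernel_comb (?d n) x) + dual_form f (?d n)" if c: "finsupp c" for c
        using dual_form_le_sqnorm[OF H finsupp_diff[OF c fs[of n]]] dual_form_diff_comb[OF finsupp_diff[OF c fs[of n]] fs[of n], of f]
        by simp
      from conjunct2[OF sqnorm_le[OF this]] show "sqnorm f - sqnorm (\<lambda>x. f x - kernel_comb (?d n) x) \<le> dual_form f (?d n)" by simp
    qed
    show "(\<lambda>n. sqnorm f - sqnorm (\<lambda>x. f x - kernel_comb (?d n) x)) \<longlonglongrightarrow> sqnorm f"
      using tendsto_diff[OF tendsto_const] approx[OF f] by (fastforce simp: approximates_def)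
  qed simp
  ultimately have "Re (ip f f) = sqnorm f" using LIMSEQ_unique by fastforce
  with im show ?thesis by (simp add: complex_eq_iff)
qed

definition delta :: "'a \<Rightarrow> 'a \<Rightarrow> complex" where
  "delta w x = (if x = w then 1 else 0)"

lemma delta: "finsupp (delta w)" "pairing f (delta w) = f w" "kernel_comb (delta w) = (\<lambda>x. s x w)"
proof -
  have "{x. delta w x \<noteq> 0} = {w}" by (auto simp: delta_def)
  then show "finsupp (delta w)" "pairing f (delta w) = f w" "kernel_comb (delta w) = (\<lambda>x. s x w)"
    by (auto simp: finsupp_def pairing_def kernel_comb_def[abs_def] delta_def)
qed

lemma ip_section:
  assumes f: "f \<in> rk_space"
  shows "ip f (\<lambda>x. s x w) = f w"
proof (rule LIMSEQ_unique)
  have "approximates (\<lambda>n. delta w) (kernel_comb (delta w))"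
    by (simp add: approximates_def delta(1) zero_rk_space)
  from ip_lim[OF f comb_rk_space(1)[OF delta(1)] this] show "(\<lambda>n. f w) \<longlonglongrightarrow> ip f (\<lambda>x. s x w)"
    by (simp add: delta)
qed simp

lemma value_bound: "f \<in> rk_space \<Longrightarrow> (cmod (f w))\<^sup>2 \<le> sqnorm f * Re (s w w)"
  using pairing_bound[OF _ delta(1)] by (simp add: delta energy_def)

lemma rk_space_complete:
  assumes F: "\<And>n. F n \<in> rk_space"
    and C: "\<And>e. e > 0 \<Longrightarrow> \<exists>M. \<forall>m\<ge>M. \<forall>n\<ge>M. sqnorm (\<lambda>x. F m x - F n x) < e"
  shows "\<exists>f\<in>rk_space. (\<lambda>n. sqnorm (\<lambda>x. F n x - f x)) \<longlonglongrightarrow> 0"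
proof -
  have H: "(\<lambda>x. F m x - F n x) \<in> rk_space" for m n using diff_rk_space[OF F F] by blast
  have "convergent (\<lambda>n. F n x)" for x
  proof -
    have "Cauchy (\<lambda>n. F n x)"
    proof (rule CauchyI)
      fix e :: real assume e: "e > 0"
      have sx: "Re (s x x) \<ge> 0" using kernel_on_diag_real(2)[OF kernel] by simp
      then obtain M where M: "\<And>m n. m \<ge> M \<Longrightarrow> n \<ge> M \<Longrightarrow> sqnorm (\<lambda>x. F m x - F n x) < e\<^sup>2 / (Re (s x x) + 1)"
        using C[of "e\<^sup>2 / (Re (s x x) + 1)"] e by auto
      have "norm (F m x - F n x) < e" if "m \<ge> M" "n \<ge> M" for m n
      proof -
        have "(norm (F m x - F n x))\<^sup>2 \<le> sqnorm (\<lambda>x. F m x - F n x) * Re (s x x)"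
          using value_bound[OF H[of m n]] by simp
        also have "\<dots> \<le> sqnorm (\<lambda>x. F m x - F n x) * (Re (s x x) + 1)"
          using sqnorm_nonneg[OF H] by (simp add: mult_left_mono)
        also have "\<dots> < e\<^sup>2" using M[OF that] sx by (simp add: field_simps)
        finally show ?thesis using e by (simp add: power_less_imp_less_base)
      qed
      then show "\<exists>M. \<forall>m\<ge>M. \<forall>n\<ge>M. norm (F m x - F n x) < e" by blast
    qed
    then show ?thesis by (simp add: Cauchy_convergent_iff)
  qed
  then obtain f where f: "\<And>x. (\<lambda>n. F n x) \<longlonglongrightarrow> f x"
    unfolding convergent_def by metis
  have b: "(\<lambda>x. F m x - f x) \<in> rk_space \<and> sqnorm (\<lambda>x. F m x - f x) \<le> e"
    if "\<And>n. n \<ge> M \<Longrightarrow> sqnorm (\<lambda>x. F m x - F n x) < e" for m M e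
  proof (rule sqnorm_le)
    fix c :: "'a \<Rightarrow> complex" assume c: "finsupp c"
    have "(\<lambda>n. dual_form (\<lambda>x. F m x - F n x) c) \<longlonglongrightarrow> dual_form (\<lambda>x. F m x - f x) c"
      unfolding dual_form_def by (intro tendsto_intros pairing_tendsto f)
    moreover have "\<forall>\<^sub>F n in sequentially. dual_form (\<lambda>x. F m x - F n x) c \<le> e"
      unfolding eventually_sequentially
      using dual_form_le_sqnorm[OF H c] that by (meson less_imp_le order_trans)
    ultimately show "dual_form (\<lambda>x. F m x - f x) c \<le> e" by (rule tendsto_upperbound) simp
  qed
  obtain M1 where "\<forall>m\<ge>M1. \<forall>n\<ge>M1. sqnorm (\<lambda>x. F m x - F n x) < 1" using C[of 1] by auto
  then have "(\<lambda>x. F M1 x - f x) \<in> rk_space" using b[of M1 M1 1] by simp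
  from conjunct1[OF diff_rk_space[OF F[of M1] this]] have fH: "f \<in> rk_space" by simp
  have "(\<lambda>n. sqnorm (\<lambda>x. F n x - f x)) \<longlonglongrightarrow> 0"
  proof (rule LIMSEQ_I)
    fix r :: real assume "r > 0"
    then obtain M where M: "\<And>m n. m \<ge> M \<Longrightarrow> n \<ge> M \<Longrightarrow> sqnorm (\<lambda>x. F m x - F n x) < r / 2"
      using C[of "r / 2"] by auto
    have "norm (sqnorm (\<lambda>x. F m x - f x) - 0) < r" if "m \<ge> M" for m
      using b[of M m "r / 2"] M[OF that] sqnorm_nonneg \<open>r > 0\<close> by fastforce
    then show "\<exists>M. \<forall>n\<ge>M. norm (sqnorm (\<lambda>x. F n x - f x) - 0) < r" by blast
  qed
  with fH show ?thesis by blast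
qed

lemma ip_add: "f \<in> rk_space \<Longrightarrow> g \<in> rk_space \<Longrightarrow> h \<in> rk_space \<Longrightarrow> ip (\<lambda>x. f x + g x) h = ip f h + ip g h"
  using ip_lim[OF conjunct1[OF add_rk_space], of f g h "approx h"] approx[of h]
    tendsto_add[OF ip_lim[of f h "approx h"] ip_lim[of g h "approx h"]]
  by (auto simp: pairing_add_left intro: LIMSEQ_unique)

lemma ip_scale: "f \<in> rk_space \<Longrightarrow> h \<in> rk_space \<Longrightarrow> ip (\<lambda>x. t * f x) h = t * ip f h"
  using ip_lim[OF conjunct1[OF scale_rk_space], of f h "approx h" t] approx[of h]
    tendsto_mult_left[OF ip_lim[of f h "approx h"], of t]
  by (auto simp: pairing_scale_left intro: LIMSEQ_unique)

text \<open>
  The adjoint of multiplication by \<open>\<Phi>\<close> sends a kernel combination \<open>c\<close> to the kernel combination with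
  coefficients \<open>\<Phi>(x)\<^sup>* c(x)\<close>, and the hypothesis says that this decreases the energy.  Hence each value
  in the supremum defining the norm of \<open>\<Phi> F\<close> is at most a value in the supremum for \<open>F\<close>.
\<close>
lemma contraction:
  fixes \<Phi> :: "'a \<Rightarrow> nat \<Rightarrow> nat \<Rightarrow> complex"
  assumes K: "kernel_on (UNIV \<times> {..<N})
      (\<lambda>(x, a) (y, b). s x y * ((if a = b then 1 else 0) - (\<Sum>c<N. \<Phi> x a c * cnj (\<Phi> y b c))))"
    and F: "\<And>b. b < N \<Longrightarrow> F b \<in> rk_space"
  shows "(\<forall>a<N. mult_op N \<Phi> F a \<in> rk_space) \<and>
      (\<Sum>a<N. sqnorm (mult_op N \<Phi> F a)) \<le> (\<Sum>b<N. sqnorm (F b))"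
proof -
  have main: "(\<Sum>a<N. dual_form (mult_op N \<Phi> F a) (c a)) \<le> (\<Sum>b<N. sqnorm (F b))"
    if c: "\<And>a. a < N \<Longrightarrow> finsupp (c a)" for c
  proof -
    define c' where "c' b x = (\<Sum>a<N. cnj (\<Phi> x a b) * c a x)" for b x
    have fs': "finsupp (c' b)" for b
      unfolding c'_def using c by (intro finsupp_sum finsupp_mult) auto
    define A where "A = (\<Union>a<N. {x. c a x \<noteq> 0})"
    have A: "finite A" using c by (auto simp: A_def finsupp_def)
    have cA: "{x. c a x \<noteq> 0} \<subseteq> A" if "a < N" for a using that by (auto simp: A_def)
    have cA': "{x. c' b x \<noteq> 0} \<subseteq> A" for b
      by (auto simp: A_def c'_def) (metis (mono_tags, lifting) lessThan_iff mult_zero_right sum.neutral)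
    have "(\<Sum>a<N. pairing (mult_op N \<Phi> F a) (c a)) = (\<Sum>a<N. \<Sum>x\<in>A. \<Sum>b<N. cnj (c a x) * (\<Phi> x a b * F b x))"
      by (intro sum.cong refl) (simp add: pairing_eq[OF A cA] mult_op_def sum_distrib_left)
    also have "\<dots> = (\<Sum>b<N. \<Sum>x\<in>A. \<Sum>a<N. cnj (c a x) * (\<Phi> x a b * F b x))"
    proof -
      have "(\<Sum>a<N. \<Sum>x\<in>A. \<Sum>b<N. h a x b) = (\<Sum>b<N. \<Sum>x\<in>A. \<Sum>a<N. h a x b)"
        for h :: "nat \<Rightarrow> 'a \<Rightarrow> nat \<Rightarrow> complex"
      proof -
        have "(\<Sum>a<N. \<Sum>x\<in>A. \<Sum>b<N. h a x b) = (\<Sum>x\<in>A. \<Sum>a<N. \<Sum>b<N. h a x b)"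
          by (rule sum.swap)
        also have "\<dots> = (\<Sum>x\<in>A. \<Sum>b<N. \<Sum>a<N. h a x b)"
          by (intro sum.cong refl sum.swap)
        also have "\<dots> = (\<Sum>b<N. \<Sum>x\<in>A. \<Sum>a<N. h a x b)"
          by (rule sum.swap)
        finally show ?thesis .
      qed
      then show ?thesis .
    qed
    also have "\<dots> = (\<Sum>b<N. pairing (F b) (c' b))"
      by (simp add: pairing_eq[OF A cA'] c'_def sum_distrib_left sum_distrib_right mult_ac)
    finally have evs: "(\<Sum>a<N. pairing (mult_op N \<Phi> F a) (c a)) = (\<Sum>b<N. pairing (F b) (c' b))" .
    define T where "T = A \<times> {..<N}"
    have ST: "(\<Sum>p\<in>T. h p) = (\<Sum>x\<in>A. \<Sum>a<N. h (x, a))" for h :: "'a \<times> nat \<Rightarrow> complex"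
      unfolding T_def by (simp add: sum.cartesian_product)
    have "(\<Sum>p\<in>T. \<Sum>q\<in>T. cnj (c (snd p) (fst p)) *
        (case p of (x, a) \<Rightarrow> \<lambda>(y, b). s x y * ((if a = b then 1 else 0) - (\<Sum>c<N. \<Phi> x a c * cnj (\<Phi> y b c)))) q *
        c (snd q) (fst q)) \<in> \<real>\<^sub>\<ge>\<^sub>0"
      using A by (intro kernel_onD[OF K]) (auto simp: T_def)
    also have "(\<Sum>p\<in>T. \<Sum>q\<in>T. cnj (c (snd p) (fst p)) *
        (case p of (x, a) \<Rightarrow> \<lambda>(y, b). s x y * ((if a = b then 1 else 0) - (\<Sum>c<N. \<Phi> x a c * cnj (\<Phi> y b c)))) q *
        c (snd q) (fst q)) =
        (\<Sum>p\<in>T. \<Sum>q\<in>T. if snd p = snd q then cnj (c (snd p) (fst p)) * s (fst p) (fst q) * c (snd q) (fst q) else 0)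
        - (\<Sum>p\<in>T. \<Sum>q\<in>T. \<Sum>b<N. cnj (cnj (\<Phi> (fst p) (snd p) b) * c (snd p) (fst p)) * s (fst p) (fst q) *
             (cnj (\<Phi> (fst q) (snd q) b) * c (snd q) (fst q)))"
      unfolding sum_subtractf[symmetric]
      by (intro sum.cong refl) (auto simp: algebra_simps sum_distrib_left sum_distrib_right)
    also have "(\<Sum>p\<in>T. \<Sum>q\<in>T. if snd p = snd q then cnj (c (snd p) (fst p)) * s (fst p) (fst q) * c (snd q) (fst q) else 0)
        = (\<Sum>a<N. complex_of_real (energy (c a)))"
    proof -
      have "(\<Sum>p\<in>T. \<Sum>q\<in>T. if snd p = snd q then cnj (c (snd p) (fst p)) * s (fst p) (fst q) * c (snd q) (fst q) else 0)
        = (\<Sum>x\<in>A. \<Sum>a<N. \<Sum>y\<in>A. \<Sum>b<N. if a = b then cnj (c a x) * s x y * c b y else 0)"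
        by (simp only: ST fst_conv snd_conv)
      also have "\<dots> = (\<Sum>x\<in>A. \<Sum>a<N. \<Sum>y\<in>A. cnj (c a x) * s x y * c a y)"
        by (intro sum.cong refl) (simp add: sum.delta)
      also have "\<dots> = (\<Sum>a<N. \<Sum>x\<in>A. \<Sum>y\<in>A. cnj (c a x) * s x y * c a y)"
        by (rule sum.swap)
      finally show ?thesis by (simp add: energy_eq_sum[OF A cA])
    qed
    also have "(\<Sum>p\<in>T. \<Sum>q\<in>T. \<Sum>b<N. cnj (cnj (\<Phi> (fst p) (snd p) b) * c (snd p) (fst p)) * s (fst p) (fst q) *
             (cnj (\<Phi> (fst q) (snd q) b) * c (snd q) (fst q))) = (\<Sum>b<N. complex_of_real (energy (c' b)))"
    proof -
      have T: "(\<Sum>p\<in>T. cnj (\<Phi> (fst p) (snd p) b) * c (snd p) (fst p) * h (fst p)) = (\<Sum>x\<in>A. c' b x * h x)" for b h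
        unfolding c'_def by (simp add: ST sum_distrib_right)
      have T': "(\<Sum>p\<in>T. cnj (cnj (\<Phi> (fst p) (snd p) b) * c (snd p) (fst p)) * h (fst p)) = (\<Sum>x\<in>A. cnj (c' b x) * h x)" for b h
        using arg_cong[OF T[of b "\<lambda>x. cnj (h x)"], of cnj] by simp
      have "(\<Sum>p\<in>T. \<Sum>q\<in>T. \<Sum>b<N. cnj (cnj (\<Phi> (fst p) (snd p) b) * c (snd p) (fst p)) * s (fst p) (fst q) *
             (cnj (\<Phi> (fst q) (snd q) b) * c (snd q) (fst q)))
        = (\<Sum>b<N. \<Sum>p\<in>T. cnj (cnj (\<Phi> (fst p) (snd p) b) * c (snd p) (fst p)) *
             (\<Sum>q\<in>T. cnj (\<Phi> (fst q) (snd q) b) * c (snd q) (fst q) * s (fst p) (fst q)))"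
        by (subst (2) sum.swap, subst sum.swap) (simp add: sum_distrib_left mult_ac)
      also have "\<dots> = (\<Sum>b<N. \<Sum>x\<in>A. cnj (c' b x) * (\<Sum>y\<in>A. c' b y * s x y))"
        unfolding T T'[of _ "\<lambda>x. \<Sum>y\<in>A. c' _ y * s x y"] ..
      finally show ?thesis
        by (simp add: energy_eq_sum[OF A cA'] sum_distrib_left mult_ac)
    qed
    finally have en: "(\<Sum>b<N. energy (c' b)) \<le> (\<Sum>a<N. energy (c a))"
      by (simp add: complex_nonneg_Reals_iff flip: of_real_sum of_real_diff)
    have "(\<Sum>a<N. dual_form (mult_op N \<Phi> F a) (c a)) \<le> (\<Sum>b<N. dual_form (F b) (c' b))"
      using en arg_cong[OF evs, of Re] by (simp add: dual_form_def sum_subtractf flip: sum_distrib_left)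
    also have "\<dots> \<le> (\<Sum>b<N. sqnorm (F b))"
      by (intro sum_mono dual_form_le_sqnorm F fs') auto
    finally show ?thesis .
  qed
  have H: "mult_op N \<Phi> F a \<in> rk_space" if a: "a < N" for a
  proof (rule conjunct1[OF sqnorm_le])
    fix c :: "'a \<Rightarrow> complex" assume c: "finsupp c"
    have "dual_form (mult_op N \<Phi> F a) c = (\<Sum>i<N. dual_form (mult_op N \<Phi> F i) (if i = a then c else (\<lambda>x. 0)))"
      using a by (subst sum.remove[of _ a]) (auto simp: dual_form_def pairing_zero_right energy_zero)
    also have "\<dots> \<le> (\<Sum>b<N. sqnorm (F b))" by (rule main) (auto simp: c finsupp_zero)
    finally show "dual_form (mult_op N \<Phi> F a) c \<le> (\<Sum>b<N. sqnorm (F b))" .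
  qed
  have "(\<Sum>a<N. sqnorm (mult_op N \<Phi> F a)) \<le> (\<Sum>b<N. sqnorm (F b))"
  proof (rule field_le_epsilon)
    fix e :: real assume e: "e > 0"
    define \<epsilon> where "\<epsilon> = e / (real N + 1)"
    have \<epsilon>: "\<epsilon> > 0" "real N * \<epsilon> \<le> e" using e by (auto simp: \<epsilon>_def field_simps)
    have "\<exists>c. finsupp c \<and> sqnorm (mult_op N \<Phi> F a) - \<epsilon> < dual_form (mult_op N \<Phi> F a) c" if "a < N" for a
    proof -
      have "\<exists>c\<in>Collect finsupp. sqnorm (mult_op N \<Phi> F a) - \<epsilon> < dual_form (mult_op N \<Phi> F a) c"
        using H[OF that] finsupp_zero \<epsilon>(1) unfolding sqnorm_def
        by (intro less_cSUP_iff[THEN iffD1]) (auto simp: rk_space_def)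
      then show ?thesis by auto
    qed
    then obtain c where c: "\<And>a. a < N \<Longrightarrow> finsupp (c a)"
      "\<And>a. a < N \<Longrightarrow> sqnorm (mult_op N \<Phi> F a) - \<epsilon> < dual_form (mult_op N \<Phi> F a) (c a)" by metis
    have "(\<Sum>a<N. sqnorm (mult_op N \<Phi> F a) - \<epsilon>) \<le> (\<Sum>a<N. dual_form (mult_op N \<Phi> F a) (c a))"
      using c(2) by (intro sum_mono) (auto intro: less_imp_le)
    also have "\<dots> \<le> (\<Sum>b<N. sqnorm (F b))" by (rule main[OF c(1)])
    finally show "(\<Sum>a<N. sqnorm (mult_op N \<Phi> F a)) \<le> (\<Sum>b<N. sqnorm (F b)) + e"
      using \<epsilon>(2) by (simp add: sum_subtractf)
  qed
  with H show ?thesis by blast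
qed

end

lemma contractive_multiplier_if_kernel:
  assumes s: "kernel_on X s"
    and K: "kernel_on (X \<times> {..<N})
      (\<lambda>(x, a) (y, b). s x y * ((if a = b then 1 else 0) - (\<Sum>c<N. \<Phi> x a c * cnj (\<Phi> y b c))))"
  shows "contractive_multiplier X s N \<Phi>"
proof -
  define s' where "s' x y = (if x \<in> X \<and> y \<in> X then s x y else 0)" for x y
  have ext: "kernel_on Y (\<lambda>x y. if x \<in> Z \<and> y \<in> Z then k x y else 0)" if k: "kernel_on Z k"
    for k :: "'b \<Rightarrow> 'b \<Rightarrow> complex" and Y Z
  proof (rule kernel_onI)
    fix A :: "'b set" and c assume A: "finite A" "A \<subseteq> Y"
    have "(\<Sum>x\<in>A. \<Sum>y\<in>A. cnj (c x) * (if x \<in> Z \<and> y \<in> Z then k x y else 0) * c y)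
        = (\<Sum>x\<in>A \<inter> Z. \<Sum>y\<in>A. cnj (c x) * (if x \<in> Z \<and> y \<in> Z then k x y else 0) * c y)"
      using A by (intro sum.mono_neutral_right) auto
    also have "\<dots> = (\<Sum>x\<in>A \<inter> Z. \<Sum>y\<in>A \<inter> Z. cnj (c x) * k x y * c y)"
      using A by (intro sum.cong refl sum.mono_neutral_cong_right) auto
    finally show "(\<Sum>x\<in>A. \<Sum>y\<in>A. cnj (c x) * (if x \<in> Z \<and> y \<in> Z then k x y else 0) * c y) \<in> \<real>\<^sub>\<ge>\<^sub>0"
      using kernel_onD[OF k, of "A \<inter> Z" c] A by simp
  qed
  interpret full_kernel s'
    by standard (unfold s'_def, rule ext[OF s])
  have sec: "kernel_section X s w = (\<lambda>x. s' x w)" if "w \<in> X" for w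
    using that by (auto simp: kernel_section_def s'_def)
  have norm: "ip_norm ip f = sqrt (sqnorm f)" if "f \<in> rk_space" for f
    using ip_self[OF that] by (simp add: ip_norm_def)
  have "rkhs X s rk_space ip"
  proof
    show "f x = 0" if "f \<in> rk_space" "x \<notin> X" for f x
      using value_bound[OF that(1), of x] that(2) by (simp add: s'_def)
    show "(\<lambda>x. 0) \<in> rk_space" by (rule zero_rk_space)
    show "(\<lambda>x. f x + g x) \<in> rk_space" if "f \<in> rk_space" "g \<in> rk_space" for f g using add_rk_space[OF that] by blast
    show "(\<lambda>x. c * f x) \<in> rk_space" if "f \<in> rk_space" for c f using scale_rk_space[OF that] by blast
    show "ip f f \<in> \<real>\<^sub>\<ge>\<^sub>0" if "f \<in> rk_space" for f using ip_self[OF that] sqnorm_nonneg[OF that] by simp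
    show "f = (\<lambda>x. 0)" if "f \<in> rk_space" "ip f f = 0" for f
      using value_bound[OF that(1)] that(2) by (simp add: ip_self[OF that(1)] fun_eq_iff)
    show "kernel_section X s w \<in> rk_space" if "w \<in> X" for w
      using comb_rk_space(1)[OF delta(1)] by (simp add: sec[OF that] delta)
    show "ip f (kernel_section X s w) = f w" if "f \<in> rk_space" "w \<in> X" for f w
      by (simp add: sec[OF that(2)] ip_section[OF that(1)])
    show "\<exists>f\<in>rk_space. (\<lambda>n. ip_norm ip (\<lambda>x. F n x - f x)) \<longlonglongrightarrow> 0"
      if F: "\<And>n. F n \<in> rk_space"
        and C: "\<And>e. e > 0 \<Longrightarrow> \<exists>M. \<forall>m\<ge>M. \<forall>n\<ge>M. ip_norm ip (\<lambda>x. F m x - F n x) < e" for F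
    proof -
      have "\<exists>M. \<forall>m\<ge>M. \<forall>n\<ge>M. sqnorm (\<lambda>x. F m x - F n x) < e" if "e > 0" for e
        using C[of "sqrt e"] that conjunct1[OF diff_rk_space[OF F F]] by (simp add: norm)
      from rk_space_complete[OF F this] obtain f where f: "f \<in> rk_space" "(\<lambda>n. sqnorm (\<lambda>x. F n x - f x)) \<longlonglongrightarrow> 0"
        by blast
      from tendsto_real_sqrt[OF f(2)] have "(\<lambda>n. ip_norm ip (\<lambda>x. F n x - f x)) \<longlonglongrightarrow> 0"
        using conjunct1[OF diff_rk_space[OF F f(1)]] by (simp add: norm)
      with f(1) show ?thesis by blast
    qed
  qed (auto intro: ip_add ip_scale ip_sym)
  moreover have K': "kernel_on (UNIV \<times> {..<N})
      (\<lambda>(x, a) (y, b). s' x y * ((if a = b then 1 else 0) - (\<Sum>c<N. \<Phi> x a c * cnj (\<Phi> y b c))))"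
    by (rule kernel_on_cong[OF ext[OF K]]) (auto simp: s'_def split: if_splits)
  have "(\<forall>a<N. mult_op N \<Phi> F a \<in> rk_space) \<and> tensor_norm ip N (mult_op N \<Phi> F) \<le> tensor_norm ip N F"
    if F: "\<forall>b<N. F b \<in> rk_space" for F
  proof -
    have n: "tensor_norm ip N G = sqrt (\<Sum>b<N. sqnorm (G b))" if "\<forall>b<N. G b \<in> rk_space" for G
      unfolding tensor_norm_def using that sqnorm_nonneg
      by (intro arg_cong[of _ _ sqrt] sum.cong) (auto simp: norm)
    show ?thesis using contraction[OF K', of F] F by (simp add: n)
  qed
  ultimately show ?thesis unfolding contractive_multiplier_def by blast
qed

context rkhs
begin

lemma section_comb:
  assumes "finite T" "\<And>p. p \<in> T \<Longrightarrow> w p \<in> X"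
  shows "(\<lambda>x. \<Sum>p\<in>T. t p * kernel_section X s (w p) x) \<in> H \<and>
    (\<forall>f\<in>H. ip f (\<lambda>x. \<Sum>p\<in>T. t p * kernel_section X s (w p) x) = (\<Sum>p\<in>T. cnj (t p) * f (w p)))"
  using assms
proof (induction T rule: finite_induct)
  case empty
  have "ip f (\<lambda>x. 0) = 0" if "f \<in> H" for f
    using ip_cnj[OF zero_mem that] ip_scale[OF zero_mem that, of 0] by simp
  then show ?case by (simp add: zero_mem)
next
  case (insert q T)
  let ?r = "\<lambda>x. \<Sum>p\<in>T. t p * kernel_section X s (w p) x"
  let ?q = "\<lambda>x. t q * kernel_section X s (w q) x"
  have r: "?r \<in> H" "\<And>f. f \<in> H \<Longrightarrow> ip f ?r = (\<Sum>p\<in>T. cnj (t p) * f (w p))"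
    using insert by auto
  have sq: "kernel_section X s (w q) \<in> H" and wq: "w q \<in> X"
    using section_mem insert.prems by auto
  have q: "?q \<in> H" by (rule scale_mem[OF sq])
  have "ip f (\<lambda>x. ?q x + ?r x) = cnj (t q) * f (w q) + (\<Sum>p\<in>T. cnj (t p) * f (w p))" if f: "f \<in> H" for f
  proof -
    have "ip f ?q = cnj (t q) * f (w q)"
      using ip_cnj[OF q f] ip_scale[OF sq f, of "t q"] ip_cnj[OF f sq] reproducing[OF f wq] by simp
    moreover have "ip f (\<lambda>x. ?q x + ?r x) = ip f ?q + ip f ?r"
      using ip_cnj[OF add_mem[OF q r(1)] f] ip_add[OF q r(1) f] ip_cnj[OF f q] ip_cnj[OF f r(1)] by simp
    ultimately show ?thesis by (simp add: r(2)[OF f])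
  qed
  then show ?case using insert.hyps add_mem[OF q r(1)] by simp
qed

text \<open>
  This is \<open>\<parallel>f - g\<parallel>\<^sup>2 \<ge> 0\<close>.
\<close>
lemma Re_ip_diff:
  assumes "f \<in> H" "g \<in> H"
  shows "2 * Re (ip f g) \<le> Re (ip f f) + Re (ip g g)"
proof -
  let ?m = "\<lambda>x. (-1) * g x" and ?d = "\<lambda>x. f x + (-1) * g x"
  have m: "?m \<in> H" and d: "?d \<in> H" by (rule scale_mem[OF assms(2)], rule add_mem[OF assms(1) scale_mem[OF assms(2)]])
  have "ip h ?m = - ip h g" if "h \<in> H" for h
    using ip_cnj[OF m that] ip_scale[OF assms(2) that, of "-1"] ip_cnj[OF that assms(2)] by simp
  moreover have "ip ?m h = - ip g h" if "h \<in> H" for h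
    using ip_scale[OF assms(2) that, of "-1"] by simp
  moreover have "ip ?d ?d = ip f f + ip f ?m + ip ?m f + ip ?m ?m"
    using ip_add[OF assms(1) m d] ip_cnj[OF d assms(1)] ip_cnj[OF d m]
      ip_add[OF assms(1) m assms(1)] ip_add[OF assms(1) m m] ip_cnj[OF assms(1) m] ip_cnj[OF assms(1) assms(1)]
      ip_cnj[OF m m]
    by simp
  ultimately have "ip ?d ?d = ip f f - ip f g - ip g f + ip g g"
    using assms m by simp
  moreover have "Re (ip ?d ?d) \<ge> 0" using ip_nonneg[OF d] by (simp add: complex_nonneg_Reals_iff)
  moreover have "Re (ip g f) = Re (ip f g)" using ip_cnj[OF assms] by simp
  ultimately show ?thesis by simp
qed

text \<open>
  For a kernel combination \<open>G\<close> let \<open>F\<close> be its image under the formal adjoint of multiplication by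
  \<open>\<Phi>\<close>.  Then \<open>\<langle>\<Phi> F, G\<rangle> = \<parallel>F\<parallel>\<^sup>2\<close>, so \<open>2 \<parallel>F\<parallel>\<^sup>2 \<le> \<parallel>\<Phi> F\<parallel>\<^sup>2 + \<parallel>G\<parallel>\<^sup>2 \<le> \<parallel>F\<parallel>\<^sup>2 + \<parallel>G\<parallel>\<^sup>2\<close>, and
  \<open>\<parallel>G\<parallel>\<^sup>2 - \<parallel>F\<parallel>\<^sup>2\<close> is the quadratic form that has to be non-negative.
\<close>
lemma kernel_if_contraction:
  assumes M: "\<And>F. (\<forall>b<N. F b \<in> H) \<Longrightarrow> (\<forall>a<N. mult_op N \<Phi> F a \<in> H) \<and>
      tensor_norm ip N (mult_op N \<Phi> F) \<le> tensor_norm ip N F"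
  shows "kernel_on (X \<times> {..<N})
      (\<lambda>(x, a) (y, b). s x y * ((if a = b then 1 else 0) - (\<Sum>c<N. \<Phi> x a c * cnj (\<Phi> y b c))))"
proof (rule kernel_onI)
  fix T and c :: "'a \<times> nat \<Rightarrow> complex"
  assume T: "finite T" "T \<subseteq> X \<times> {..<N}"
  then have fX: "fst p \<in> X" and sN: "snd p < N" if "p \<in> T" for p using that by auto
  define tF where "tF b p = cnj (\<Phi> (fst p) (snd p) b) * c p" for b p
  define tG where "tG a p = (if snd p = a then c p else 0)" for a p
  define F where "F b = (\<lambda>x. \<Sum>p\<in>T. tF b p * kernel_section X s (fst p) x)" for b
  define G where "G a = (\<lambda>x. \<Sum>p\<in>T. tG a p * kernel_section X s (fst p) x)" for a
  define MF where "MF = mult_op N \<Phi> F"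
  have F: "F b \<in> H" "\<And>f. f \<in> H \<Longrightarrow> ip f (F b) = (\<Sum>p\<in>T. cnj (tF b p) * f (fst p))" for b
    using section_comb[OF T(1), of fst "tF b"] fX by (auto simp: F_def)
  have G: "G a \<in> H" "\<And>f. f \<in> H \<Longrightarrow> ip f (G a) = (\<Sum>p\<in>T. cnj (tG a p) * f (fst p))" for a
    using section_comb[OF T(1), of fst "tG a"] fX by (auto simp: G_def)
  have MF: "MF a \<in> H" if "a < N" for a
    using M[of F] F that by (auto simp: MF_def)
  have le: "tensor_norm ip N MF \<le> tensor_norm ip N F"
    using M[of F] F by (auto simp: MF_def)
  have norm: "(ip_norm ip f)\<^sup>2 = Re (ip f f)" if "f \<in> H" for f
    using ip_nonneg[OF that] by (simp add: ip_norm_def complex_nonneg_Reals_iff)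
  have "(\<Sum>a<N. Re (ip (MF a) (MF a))) \<le> (\<Sum>b<N. Re (ip (F b) (F b)))"
    using le by (simp add: tensor_norm_def norm F MF)
  moreover have "(\<Sum>a<N. ip (MF a) (G a)) = (\<Sum>b<N. ip (F b) (F b))"
  proof -
    have "(\<Sum>a<N. ip (MF a) (G a)) = (\<Sum>p\<in>T. \<Sum>a<N. cnj (tG a p) * MF a (fst p))"
      by (subst sum.swap) (simp add: G(2) MF)
    also have "\<dots> = (\<Sum>p\<in>T. cnj (c p) * MF (snd p) (fst p))"
    proof (rule sum.cong[OF refl])
      fix p assume p: "p \<in> T"
      have "(\<Sum>a<N. cnj (tG a p) * MF a (fst p)) = (\<Sum>a<N. if snd p = a then cnj (c p) * MF a (fst p) else 0)"
        by (intro sum.cong) (auto simp: tG_def)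
      then show "(\<Sum>a<N. cnj (tG a p) * MF a (fst p)) = cnj (c p) * MF (snd p) (fst p)"
        using sN[OF p] by simp
    qed
    also have "\<dots> = (\<Sum>p\<in>T. \<Sum>b<N. cnj (tF b p) * F b (fst p))"
      by (simp add: MF_def mult_op_def tF_def sum_distrib_left mult_ac)
    also have "\<dots> = (\<Sum>b<N. ip (F b) (F b))"
      by (subst sum.swap) (simp add: F)
    finally show ?thesis .
  qed
  then have "(\<Sum>b<N. Re (ip (F b) (F b))) = (\<Sum>a<N. Re (ip (MF a) (G a)))"
    by (metis Re_sum)
  moreover have "(\<Sum>a<N. 2 * Re (ip (MF a) (G a))) \<le> (\<Sum>a<N. Re (ip (MF a) (MF a)) + Re (ip (G a) (G a)))"
    by (intro sum_mono Re_ip_diff MF G) auto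
  ultimately have le: "(\<Sum>b<N. Re (ip (F b) (F b))) \<le> (\<Sum>a<N. Re (ip (G a) (G a)))"
    by (simp add: sum.distrib flip: sum_distrib_left)
  have "Im (ip f f) = 0" if "f \<in> H" for f
    using ip_nonneg[OF that] by (simp add: complex_nonneg_Reals_iff)
  with le F(1) G(1) have pos: "(\<Sum>a<N. ip (G a) (G a)) - (\<Sum>b<N. ip (F b) (F b)) \<in> \<real>\<^sub>\<ge>\<^sub>0"
    by (simp add: complex_nonneg_Reals_iff)
  have "(\<Sum>a<N. ip (G a) (G a)) = (\<Sum>p\<in>T. \<Sum>q\<in>T. cnj (c p) * (s (fst p) (fst q) * (if snd p = snd q then 1 else 0)) * c q)"
  proof -
    have "(\<Sum>a<N. ip (G a) (G a)) = (\<Sum>a<N. \<Sum>p\<in>T. \<Sum>q\<in>T. cnj (tG a p) * s (fst p) (fst q) * tG a q)"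
      using fX by (simp add: G, simp add: G_def kernel_section_def sum_distrib_left mult_ac)
    also have "\<dots> = (\<Sum>p\<in>T. \<Sum>q\<in>T. \<Sum>a<N. cnj (tG a p) * s (fst p) (fst q) * tG a q)"
      by (subst sum.swap, intro sum.cong refl, rule sum.swap)
    also have "\<dots> = (\<Sum>p\<in>T. \<Sum>q\<in>T. cnj (c p) * (s (fst p) (fst q) * (if snd p = snd q then 1 else 0)) * c q)"
    proof (intro sum.cong refl)
      fix p q assume p: "p \<in> T"
      have "(\<Sum>a<N. cnj (tG a p) * s (fst p) (fst q) * tG a q) =
          (\<Sum>a<N. if snd p = a then cnj (c p) * s (fst p) (fst q) * tG (snd p) q else 0)"
        by (intro sum.cong) (auto simp: tG_def)
      then show "(\<Sum>a<N. cnj (tG a p) * s (fst p) (fst q) * tG a q) =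
          cnj (c p) * (s (fst p) (fst q) * (if snd p = snd q then 1 else 0)) * c q"
        using sN[OF p] by (simp add: tG_def)
    qed
    finally show ?thesis .
  qed
  moreover have "(\<Sum>b<N. ip (F b) (F b)) = (\<Sum>p\<in>T. \<Sum>q\<in>T. cnj (c p) *
      (s (fst p) (fst q) * (\<Sum>b<N. \<Phi> (fst p) (snd p) b * cnj (\<Phi> (fst q) (snd q) b))) * c q)"
  proof -
    have "(\<Sum>b<N. ip (F b) (F b)) = (\<Sum>b<N. \<Sum>p\<in>T. \<Sum>q\<in>T. cnj (tF b p) * s (fst p) (fst q) * tF b q)"
      using fX by (simp add: F, simp add: F_def kernel_section_def sum_distrib_left mult_ac)
    also have "\<dots> = (\<Sum>p\<in>T. \<Sum>q\<in>T. \<Sum>b<N. cnj (tF b p) * s (fst p) (fst q) * tF b q)"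
      by (subst sum.swap, intro sum.cong refl, rule sum.swap)
    finally show ?thesis
      by (simp add: tF_def sum_distrib_left sum_distrib_right mult_ac)
  qed
  ultimately have "(\<Sum>p\<in>T. \<Sum>q\<in>T. cnj (c p) *
      (s (fst p) (fst q) * ((if snd p = snd q then 1 else 0) - (\<Sum>b<N. \<Phi> (fst p) (snd p) b * cnj (\<Phi> (fst q) (snd q) b)))) * c q)
      \<in> \<real>\<^sub>\<ge>\<^sub>0"
    using pos by (simp only: right_diff_distrib left_diff_distrib sum_subtractf)
  then show "(\<Sum>p\<in>T. \<Sum>q\<in>T. cnj (c p) * (case p of (x, a) \<Rightarrow> \<lambda>(y, b).
      s x y * ((if a = b then 1 else 0) - (\<Sum>c<N. \<Phi> x a c * cnj (\<Phi> y b c)))) q * c q) \<in> \<real>\<^sub>\<ge>\<^sub>0"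
    by (simp only: case_prod_unfold)
qed

end

lemma kernel_if_contractive_multiplier:
  assumes "contractive_multiplier X s N \<Phi>"
  shows "kernel_on (X \<times> {..<N})
      (\<lambda>(x, a) (y, b). s x y * ((if a = b then 1 else 0) - (\<Sum>c<N. \<Phi> x a c * cnj (\<Phi> y b c))))"
proof -
  obtain H ip where r: "rkhs X s H ip" and M: "\<And>F. (\<forall>b<N. F b \<in> H) \<Longrightarrow> (\<forall>a<N. mult_op N \<Phi> F a \<in> H) \<and>
      tensor_norm ip N (mult_op N \<Phi> F) \<le> tensor_norm ip N F"
    using assms unfolding contractive_multiplier_def by blast
  show ?thesis by (rule rkhs.kernel_if_contraction[OF r M])
qed

section \<open>Sufficiency of the geometric form for the complete Pick property\<close>

lemma kernel_on_identity: "kernel_on {..<N :: nat} (\<lambda>a b. if a = b then 1 else 0)"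
proof -
  have "kernel_on {..<N} (\<lambda>a b. \<Sum>c<N. (if a = c then 1 else 0) * cnj (if b = c then 1 else 0))"
    by (intro kernel_on_sum kernel_on_rank_one)
  then show ?thesis
  proof (rule kernel_on_cong)
    fix a b assume ab: "a \<in> {..<N}" "b \<in> {..<N}"
    have "(\<Sum>c<N. (if a = c then 1 else 0) * cnj (if b = c then 1 else 0)) =
        (\<Sum>c<N. if a = c then (if b = a then 1 else 0) else 0 :: complex)"
      by (intro sum.cong) auto
    with ab show "(\<Sum>c<N. (if a = c then 1 else 0) * cnj (if b = c then 1 else 0)) = (if a = b then 1 else 0 :: complex)"
      by auto
  qed
qed

lemma sum_mult_cnj_self: "(\<Sum>q\<in>T. v q * cnj (v q)) = complex_of_real (\<Sum>q\<in>T. (cmod (v q))\<^sup>2)"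
  by (simp only: of_real_sum complex_norm_square)

text \<open>
  Think of \<open>K w w'\<close> as the inner product of vectors \<open>u w\<close> and \<open>u w'\<close> of a Hilbert space.  The Gram
  condition says that \<open>u (\<alpha> i) \<mapsto> y i\<close> extends to an isometry of the spans, and \<open>v w\<close> is the image of
  \<open>u w\<close> under that isometry composed with the orthogonal projection onto the span of the \<open>u (\<alpha> i)\<close>;
  positivity of the difference says that this composition is a contraction.  The proof is the
  Gram-Schmidt process.  The third conclusion, that \<open>v w\<close> lies in the span of the \<open>y i\<close>, provides
  the orthogonality used in the induction.
\<close>
lemma isometry_extension:
  fixes K :: "'u \<Rightarrow> 'u \<Rightarrow> complex" and y :: "'i \<Rightarrow> 'q \<Rightarrow> complex"
  assumes "finite I" "finite T" "kernel_on U K" "\<And>i. i \<in> I \<Longrightarrow> \<alpha> i \<in> U"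
    and "\<And>i j. i \<in> I \<Longrightarrow> j \<in> I \<Longrightarrow> K (\<alpha> i) (\<alpha> j) = (\<Sum>q\<in>T. y i q * cnj (y j q))"
  shows "\<exists>v. kernel_on U (\<lambda>w w'. K w w' - (\<Sum>q\<in>T. v w q * cnj (v w' q))) \<and>
      (\<forall>i\<in>I. \<forall>q\<in>T. v (\<alpha> i) q = y i q) \<and>
      (\<forall>w\<in>U. \<exists>g. \<forall>q\<in>T. v w q = (\<Sum>i\<in>I. g i * y i q))"
  using assms(1,3-5)
proof (induction I arbitrary: K y rule: finite_induct)
  case empty
  then show ?case by (intro exI[of _ "\<lambda>_ _. 0"]) simp
next
  case (insert j I)
  note K = insert.prems(1)
  have \<alpha>: "\<alpha> j \<in> U" "\<And>i. i \<in> I \<Longrightarrow> \<alpha> i \<in> U" using insert.prems(2) by auto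
  note gram = insert.prems(3)
  define k where "k = K (\<alpha> j) (\<alpha> j)"
  have vanish: "v w q = 0" if D: "kernel_on U (\<lambda>w w'. L w w' - (\<Sum>q\<in>T. v w q * cnj (v w' q)))"
    and "w \<in> U" "L w w = 0" "q \<in> T" for L v w q
  proof -
    have "- complex_of_real (\<Sum>q\<in>T. (cmod (v w q))\<^sup>2) \<in> \<real>\<^sub>\<ge>\<^sub>0"
      using kernel_on_diag[OF D \<open>w \<in> U\<close>] \<open>L w w = 0\<close> by (simp add: sum_mult_cnj_self)
    then have "(\<Sum>q\<in>T. (cmod (v w q))\<^sup>2) \<le> 0" by (simp add: complex_nonneg_Reals_iff)
    then have "(\<Sum>q\<in>T. (cmod (v w q))\<^sup>2) = 0" by (intro antisym sum_nonneg) auto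
    then show ?thesis using \<open>finite T\<close> \<open>q \<in> T\<close> by (simp add: sum_nonneg_eq_0_iff)
  qed
  show ?case
  proof (cases "k = 0")
    case True
    obtain v where v: "kernel_on U (\<lambda>w w'. K w w' - (\<Sum>q\<in>T. v w q * cnj (v w' q)))"
      "\<And>i q. i \<in> I \<Longrightarrow> q \<in> T \<Longrightarrow> v (\<alpha> i) q = y i q"
      "\<And>w. w \<in> U \<Longrightarrow> \<exists>g. \<forall>q\<in>T. v w q = (\<Sum>i\<in>I. g i * y i q)"
      using insert.IH[OF K \<alpha>(2) gram] by (auto 4 4)
    have "complex_of_real (\<Sum>q\<in>T. (cmod (y j q))\<^sup>2) = 0"
      using gram[of j j] True by (simp only: sum_mult_cnj_self k_def insertI1)
    then have yj: "y j q = 0" if "q \<in> T" for q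
      using \<open>finite T\<close> that by (simp add: sum_nonneg_eq_0_iff flip: of_real_power of_real_sum)
    have "v (\<alpha> j) q = 0" if "q \<in> T" for q
      using vanish[OF v(1) \<alpha>(1) _ that] True by (simp add: k_def)
    moreover have "\<exists>g. \<forall>q\<in>T. v w q = (\<Sum>i\<in>insert j I. g i * y i q)" if "w \<in> U" for w
      using v(3)[OF that] yj insert.hyps by auto
    ultimately show ?thesis using v(1,2) yj by (intro exI[of _ v]) auto
  next
    case False
    have kr: "cnj k = k" unfolding k_def by (rule kernel_on_hermitian[OF K \<alpha>(1) \<alpha>(1), symmetric])
    define c where "c w = K w (\<alpha> j) / k" for w
    have cc: "cnj (c w) = K (\<alpha> j) w / k" if "w \<in> U" for w
      using kernel_on_hermitian[OF K that \<alpha>(1)] kr by (simp add: c_def)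
    define y' where "y' i q = y i q - c (\<alpha> i) * y j q" for i q
    have yy': "(\<Sum>q\<in>T. y' i q * cnj (y j q)) = 0" if "i \<in> I" for i
    proof -
      have "(\<Sum>q\<in>T. y' i q * cnj (y j q)) = (\<Sum>q\<in>T. y i q * cnj (y j q)) - c (\<alpha> i) * (\<Sum>q\<in>T. y j q * cnj (y j q))"
        by (simp add: y'_def left_diff_distrib sum_subtractf sum_distrib_left mult.assoc)
      also have "\<dots> = K (\<alpha> i) (\<alpha> j) - c (\<alpha> i) * k"
        using gram[of i j] gram[of j j] that by (simp add: k_def)
      finally show ?thesis using False by (simp add: c_def)
    qed
    have gram': "kernel_at K (\<alpha> j) (\<alpha> i) (\<alpha> i') = (\<Sum>q\<in>T. y' i q * cnj (y' i' q))"
      if "i \<in> I" "i' \<in> I" for i i'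
    proof -
      have "(\<Sum>q\<in>T. y' i q * cnj (y' i' q)) =
          (\<Sum>q\<in>T. y' i q * cnj (y i' q)) - cnj (c (\<alpha> i')) * (\<Sum>q\<in>T. y' i q * cnj (y j q))"
        by (simp add: y'_def[of i'] right_diff_distrib sum_subtractf sum_distrib_left mult_ac)
      also have "\<dots> = (\<Sum>q\<in>T. y i q * cnj (y i' q)) - c (\<alpha> i) * (\<Sum>q\<in>T. y j q * cnj (y i' q))"
        by (simp add: yy'[OF that(1)]) (simp add: y'_def algebra_simps sum_subtractf sum_distrib_left)
      also have "\<dots> = kernel_at K (\<alpha> j) (\<alpha> i) (\<alpha> i')"
        using gram[of i i'] gram[of j i'] that by (simp add: kernel_at_def c_def k_def)
      finally show ?thesis ..
    qed
    obtain v where v: "kernel_on U (\<lambda>w w'. kernel_at K (\<alpha> j) w w' - (\<Sum>q\<in>T. v w q * cnj (v w' q)))"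
      "\<And>i q. i \<in> I \<Longrightarrow> q \<in> T \<Longrightarrow> v (\<alpha> i) q = y' i q"
      "\<And>w. w \<in> U \<Longrightarrow> \<exists>g. \<forall>q\<in>T. v w q = (\<Sum>i\<in>I. g i * y' i q)"
      using insert.IH[OF kernel_on_kernel_at[OF K \<alpha>(1)] \<alpha>(2) gram'] by (auto 4 4)
    define v' where "v' w q = v w q + c w * y j q" for w q
    have orth: "(\<Sum>q\<in>T. v w q * cnj (y j q)) = 0" if w: "w \<in> U" for w
    proof -
      obtain g where g: "\<And>q. q \<in> T \<Longrightarrow> v w q = (\<Sum>i\<in>I. g i * y' i q)" using v(3)[OF w] by blast
      have "(\<Sum>q\<in>T. v w q * cnj (y j q)) = (\<Sum>i\<in>I. g i * (\<Sum>q\<in>T. y' i q * cnj (y j q)))"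
        by (simp add: g sum_distrib_left sum_distrib_right mult.assoc) (rule sum.swap)
      then show ?thesis by (simp add: yy')
    qed
    have "kernel_on U (\<lambda>w w'. K w w' - (\<Sum>q\<in>T. v' w q * cnj (v' w' q)))"
    proof (rule kernel_on_cong[OF v(1)])
      fix w w' assume w: "w \<in> U" "w' \<in> U"
      have orth': "(\<Sum>q\<in>T. y j q * cnj (v w' q)) = 0"
        using arg_cong[OF orth[OF w(2)], of cnj] by (simp add: mult.commute)
      have "(\<Sum>q\<in>T. v' w q * cnj (v' w' q)) = (\<Sum>q\<in>T. v w q * cnj (v w' q))
          + cnj (c w') * (\<Sum>q\<in>T. v w q * cnj (y j q)) + c w * (\<Sum>q\<in>T. y j q * cnj (v w' q))
          + c w * cnj (c w') * (\<Sum>q\<in>T. y j q * cnj (y j q))"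
        by (simp add: v'_def algebra_simps sum.distrib sum_distrib_left)
      also have "(\<Sum>q\<in>T. y j q * cnj (y j q)) = k" using gram[of j j] by (simp add: k_def)
      finally show "kernel_at K (\<alpha> j) w w' - (\<Sum>q\<in>T. v w q * cnj (v w' q)) =
          K w w' - (\<Sum>q\<in>T. v' w q * cnj (v' w' q))"
        using False by (simp add: orth[OF w(1)] orth' cc[OF w(2)]) (simp add: c_def kernel_at_def k_def)
    qed
    moreover have "v (\<alpha> j) q = 0" if "q \<in> T" for q
      using vanish[OF v(1) \<alpha>(1) _ that] kernel_at_base[OF K \<alpha>(1) \<alpha>(1)] by simp
    then have "\<forall>i\<in>insert j I. \<forall>q\<in>T. v' (\<alpha> i) q = y i q"
      using v(2) False by (auto simp: v'_def y'_def c_def k_def)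
    moreover have "\<exists>g. \<forall>q\<in>T. v' w q = (\<Sum>i\<in>insert j I. g i * y i q)" if w: "w \<in> U" for w
    proof -
      obtain g where g: "\<And>q. q \<in> T \<Longrightarrow> v w q = (\<Sum>i\<in>I. g i * y' i q)" using v(3)[OF w] by blast
      let ?g = "g(j := c w - (\<Sum>i\<in>I. g i * c (\<alpha> i)))"
      have "v' w q = (\<Sum>i\<in>insert j I. ?g i * y i q)" if "q \<in> T" for q
      proof -
        have "(\<Sum>i\<in>I. ?g i * y i q) = (\<Sum>i\<in>I. g i * y i q)"
          using insert.hyps by (intro sum.cong) auto
        then show ?thesis
          using insert.hyps g[OF that]
          by (simp add: v'_def y'_def algebra_simps sum_subtractf sum_distrib_left)
      qed
      then show ?thesis by blast
    qed
    ultimately show ?thesis by (intro exI[of _ v']) blast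
  qed
qed

text \<open>
  Banach's fixed point theorem for the Euclidean distance on the first \<open>m\<close> coordinates; the number
  \<open>m\<close> depends on the interpolation problem, so it is not encoded in a type.
\<close>
lemma contraction_fixed_point:
  fixes G :: "(nat \<Rightarrow> complex) \<Rightarrow> nat \<Rightarrow> complex"
  assumes r: "0 \<le> r" "r < 1"
    and G: "\<And>\<beta> \<beta>'. (\<Sum>t<m. (cmod (G \<beta> t - G \<beta>' t))\<^sup>2) \<le> r * (\<Sum>t<m. (cmod (\<beta> t - \<beta>' t))\<^sup>2)"
  shows "\<exists>\<beta>. \<forall>t<m. G \<beta> t = \<beta> t"
proof -
  define b where "b n = (G ^^ n) (\<lambda>_. 0)" for n
  have b: "b (Suc n) = G (b n)" for n by (simp add: b_def)
  define S where "S = (\<Sum>t<m. (cmod (b 1 t - b 0 t))\<^sup>2)"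
  have step: "(\<Sum>t<m. (cmod (b (Suc n) t - b n t))\<^sup>2) \<le> r ^ n * S" for n
  proof (induction n)
    case 0
    then show ?case by (simp add: S_def)
  next
    case (Suc n)
    have "(\<Sum>t<m. (cmod (b (Suc (Suc n)) t - b (Suc n) t))\<^sup>2) \<le> r * (\<Sum>t<m. (cmod (b (Suc n) t - b n t))\<^sup>2)"
      using G[of "b (Suc n)" "b n"] by (simp only: b[symmetric])
    also have "\<dots> \<le> r * (r ^ n * S)" by (rule mult_left_mono[OF Suc r(1)])
    finally show ?case by simp
  qed
  have "convergent (\<lambda>n. b n t)" if t: "t < m" for t
  proof -
    have "cmod (b (Suc n) t - b n t) \<le> sqrt r ^ n * sqrt S" for n
    proof -
      have "(cmod (b (Suc n) t - b n t))\<^sup>2 \<le> (\<Sum>t<m. (cmod (b (Suc n) t - b n t))\<^sup>2)"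
        using t by (intro member_le_sum) auto
      with step[of n] have "(cmod (b (Suc n) t - b n t))\<^sup>2 \<le> r ^ n * S" by simp
      then have "cmod (b (Suc n) t - b n t) \<le> sqrt (r ^ n * S)" by (rule real_le_rsqrt)
      then show ?thesis by (simp only: real_sqrt_mult real_sqrt_power)
    qed
    moreover have "summable (\<lambda>n. sqrt r ^ n * sqrt S)"
      using r by (intro summable_mult2 summable_geometric) simp
    ultimately have "summable (\<lambda>n. b (Suc n) t - b n t)"
      by (rule summable_comparison_test'[of "\<lambda>n. sqrt r ^ n * sqrt S" 0, rotated])
    then have "convergent (\<lambda>n. \<Sum>i<n. b (Suc i) t - b i t)" by (simp add: summable_iff_convergent)
    then have "convergent (\<lambda>n. b n t - b 0 t)" by (simp only: sum_lessThan_telescope[of "\<lambda>n. b n t"])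
    then show ?thesis by (simp only: convergent_diff_const_right_iff)
  qed
  then obtain L where L: "\<And>t. t < m \<Longrightarrow> (\<lambda>n. b n t) \<longlonglongrightarrow> L t"
    unfolding convergent_def by metis
  have "G L t = L t" if t: "t < m" for t
  proof (rule LIMSEQ_unique)
    show "(\<lambda>n. b (Suc n) t) \<longlonglongrightarrow> L t" using L[OF t] by (rule LIMSEQ_Suc)
    have "(\<lambda>n. r * (\<Sum>t<m. (cmod (b n t - L t))\<^sup>2)) \<longlonglongrightarrow> r * (\<Sum>t<m. (cmod (L t - L t))\<^sup>2)"
      by (intro tendsto_intros L) auto
    then have "(\<lambda>n. r * (\<Sum>t<m. (cmod (b n t - L t))\<^sup>2)) \<longlonglongrightarrow> 0" by simp
    moreover have "(cmod (b (Suc n) t - G L t))\<^sup>2 \<le> r * (\<Sum>t<m. (cmod (b n t - L t))\<^sup>2)" for n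
    proof -
      have "(cmod (b (Suc n) t - G L t))\<^sup>2 \<le> (\<Sum>t<m. (cmod (G (b n) t - G L t))\<^sup>2)"
        unfolding b using t by (intro member_le_sum) auto
      also have "\<dots> \<le> r * (\<Sum>t<m. (cmod (b n t - L t))\<^sup>2)" by (rule G)
      finally show ?thesis .
    qed
    ultimately have "(\<lambda>n. b (Suc n) t - G L t) \<longlonglongrightarrow> 0" by (rule square_tendsto_zero[rotated])
    then show "(\<lambda>n. b (Suc n) t) \<longlonglongrightarrow> G L t" by (simp add: LIM_zero_iff)
  qed
  then show ?thesis by blast
qed

text \<open>
  A lurking isometry argument.  Positivity of the Pick matrix gives vectors \<open>b\<close> with
  \<open>p(z_i,z_j) \<langle>b_ia,b_jb\<rangle> + \<delta>_ab = \<langle>b_ia,b_jb\<rangle> + \<Sum>\<^sub>c W_i(a,c) W_j(b,c)\<^sup>*\<close>.  So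
  \<open>\<phi>(z_i) \<otimes> b_ia + e_a \<mapsto> b_ia + (row a of W_i)\<close>, where \<open>p(x,y) = \<langle>\<phi>(x),\<phi>(y)\<rangle>\<close>, is isometric and extends to a
  contraction \<open>v\<close>.  For every point \<open>x\<close> the equation \<open>\<beta> =\<close> first component of
  \<open>v (\<phi>(x) \<otimes> \<beta> + e_a)\<close> has a unique solution, since \<open>\<parallel>\<phi>(x)\<parallel> < 1\<close>, and the second component at that solution is
  declared to be row \<open>a\<close> of \<open>\<Phi>(x)\<close>.  Contractivity of \<open>v\<close> makes
  \<open>I - \<Phi>(x) \<Phi>(y)\<^sup>* - (1 - p(x,y)) B(x) B(y)\<^sup>*\<close> a positive kernel, so \<open>s(x,y) (I - \<Phi>(x) \<Phi>(y)\<^sup>*)\<close> is the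
  sum of \<open>s\<close> times that kernel and of \<open>f(x) f(y)\<^sup>* B(x) B(y)\<^sup>*\<close>.
  Uniqueness of the fixed point at \<open>z_i\<close> gives interpolation.
\<close>
lemma complete_pick_kernel_geometric:
  fixes p :: "'a \<Rightarrow> 'a \<Rightarrow> complex"
  assumes p: "kernel_on X p" and p1: "\<And>x. x \<in> X \<Longrightarrow> Re (p x x) < 1"
    and f: "\<And>x. x \<in> X \<Longrightarrow> f x \<noteq> 0"
  shows "complete_pick_kernel X (\<lambda>x y. f x * cnj (f y) / (1 - p x y))"
proof -
  define s where "s x y = f x * cnj (f y) / (1 - p x y)" for x y
  have ne: "1 - p x y \<noteq> 0" if "x \<in> X" "y \<in> X" for x y
    using kernel_on_norm_less_one[OF p p1 that] by auto
  have s: "kernel_on X s"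
    using kernel_on_conjugate[OF kernel_on_geometric[OF p p1], of f]
    by (rule kernel_on_cong) (simp_all add: s_def)
  have "\<exists>\<Phi>. contractive_multiplier X s N \<Phi> \<and> (\<forall>i<n. \<forall>a<N. \<forall>b<N. \<Phi> (z i) a b = W i a b)"
    if z: "\<And>i. i < n \<Longrightarrow> z i \<in> X" and pick: "psd_matrix ({..<n} \<times> {..<N}) (pick_matrix s N z W)"
    for n N :: nat and z W
  proof -
    define I where "I = {..<n} \<times> {..<N}"
    have I: "finite I" by (simp add: I_def)
    define m where "m = card I"
    define \<delta> where "\<delta> a b = (if a = b then 1 else 0 :: complex)" for a b :: nat
    define M where "M = (\<lambda>(i, a) (j, b). (\<delta> a b - (\<Sum>c<N. W i a c * cnj (W j b c))) / (1 - p (z i) (z j)))"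
    have "kernel_on I (pick_matrix s N z W)" using pick I by (simp add: I_def kernel_on_finite_iff)
    from kernel_on_conjugate[OF this, of "\<lambda>(i, a). 1 / f (z i)"] have "kernel_on I M"
      by (rule kernel_on_cong) (auto simp: M_def pick_matrix_def s_def I_def \<delta>_def z f)
    then obtain b :: "nat \<times> nat \<Rightarrow> nat \<Rightarrow> complex" where
      b: "\<And>\<alpha> \<beta>. \<alpha> \<in> I \<Longrightarrow> \<beta> \<in> I \<Longrightarrow> M \<alpha> \<beta> = (\<Sum>t<m. b \<alpha> t * cnj (b \<beta> t))"
      using kernel_on_factorization[OF I order_refl] unfolding m_def by blast
    define U where "U = X \<times> (UNIV :: (nat \<Rightarrow> complex) set) \<times> {..<N}"
    \<comment> \<open>The Gram kernel of the vectors \<open>\<phi>(x) \<otimes> \<beta> + e_a\<close>.\<close>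
    define K where "K = (\<lambda>(x, \<beta>, a) (y, \<beta>', b).
        p x y * (\<Sum>t<m. \<beta> t * cnj (\<beta>' t)) + \<delta> a b)"
    have K: "kernel_on U K"
    proof -
      have "kernel_on U (\<lambda>u u'. p (fst u) (fst u') * (\<Sum>t<m. fst (snd u) t * cnj (fst (snd u') t))
          + \<delta> (snd (snd u)) (snd (snd u')))"
        unfolding \<delta>_def
        by (intro kernel_on_add kernel_on_mult kernel_on_sum kernel_on_rank_one
            kernel_on_pullback[OF p] kernel_on_pullback[OF kernel_on_identity[of N]]) (auto simp: U_def)
      then show ?thesis by (rule kernel_on_cong) (auto simp: K_def)
    qed
    define \<alpha> where "\<alpha> = (\<lambda>(i, a). (z i, b (i, a), a))"
    define y where "y = (\<lambda>(i, a). case_sum (b (i, a)) (W i a))"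
    define T where "T = {..<m} <+> {..<N}"
    have T: "finite T" by (simp add: T_def)
    have sumT: "(\<Sum>q\<in>T. h q) = (\<Sum>t<m. h (Inl t)) + (\<Sum>c<N. h (Inr c))" for h :: "nat + nat \<Rightarrow> 'b::comm_monoid_add"
      by (simp add: T_def sum.Plus)
    have \<alpha>: "\<alpha> i \<in> U" if "i \<in> I" for i using that z by (auto simp: \<alpha>_def U_def I_def)
    have gram: "K (\<alpha> i) (\<alpha> j) = (\<Sum>q\<in>T. y i q * cnj (y j q))" if ij: "i \<in> I" "j \<in> I" for i j
    proof -
      obtain i1 a j1 a' where e: "i = (i1, a)" "j = (j1, a')" by fastforce
      have "z i1 \<in> X" "z j1 \<in> X" using ij z by (auto simp: e I_def)
      then have "M i j * (1 - p (z i1) (z j1)) = \<delta> a a' - (\<Sum>c<N. W i1 a c * cnj (W j1 a' c))"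
        using ne by (simp add: M_def e)
      moreover have "K (\<alpha> i) (\<alpha> j) = p (z i1) (z j1) * M i j + \<delta> a a'"
        using b[OF ij] by (simp add: K_def \<alpha>_def e)
      moreover have "(\<Sum>q\<in>T. y i q * cnj (y j q)) = M i j + (\<Sum>c<N. W i1 a c * cnj (W j1 a' c))"
        using b[OF ij] by (simp add: sumT y_def e)
      ultimately show ?thesis by (simp add: algebra_simps)
    qed
    obtain v where D: "kernel_on U (\<lambda>w w'. K w w' - (\<Sum>q\<in>T. v w q * cnj (v w' q)))"
      and v\<alpha>: "\<And>i q. i \<in> I \<Longrightarrow> q \<in> T \<Longrightarrow> v (\<alpha> i) q = y i q"
      using isometry_extension[where \<alpha> = \<alpha> and y = y, OF I T K \<alpha> gram] by blast
    \<comment> \<open>Positivity at \<open>(x, \<beta>, a)\<close> and \<open>(x, \<beta>', a)\<close> with coefficients \<open>1\<close> and \<open>-1\<close>: the map \<open>v\<close> contracts by the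
      factor \<open>\<parallel>\<phi>(x)\<parallel>\<close>.\<close>
    have dist: "(\<Sum>q\<in>T. (cmod (v (x, \<beta>, a) q - v (x, \<beta>', a) q))\<^sup>2) \<le> Re (p x x) * (\<Sum>t<m. (cmod (\<beta> t - \<beta>' t))\<^sup>2)"
      if x: "x \<in> X" and a: "a < N" for x a \<beta> \<beta>'
    proof -
      let ?u = "(x, \<beta>, a)" and ?u' = "(x, \<beta>', a)"
      have sq: "(\<Sum>q\<in>A. g q * cnj (g q)) - (\<Sum>q\<in>A. h q * cnj (g q)) - (\<Sum>q\<in>A. g q * cnj (h q)) + (\<Sum>q\<in>A. h q * cnj (h q))
          = complex_of_real (\<Sum>q\<in>A. (cmod (g q - h q))\<^sup>2)" for g h :: "'c \<Rightarrow> complex" and A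
        unfolding sum_mult_cnj_self[symmetric] by (simp add: algebra_simps sum.distrib sum_subtractf)
      have "?u \<in> U" "?u' \<in> U" using x a by (auto simp: U_def)
      from kernel_on_pair[OF D this, of "-1"]
      have "(K ?u ?u - K ?u' ?u - K ?u ?u' + K ?u' ?u')
          - ((\<Sum>q\<in>T. v ?u q * cnj (v ?u q)) - (\<Sum>q\<in>T. v ?u' q * cnj (v ?u q)) - (\<Sum>q\<in>T. v ?u q * cnj (v ?u' q))
             + (\<Sum>q\<in>T. v ?u' q * cnj (v ?u' q))) \<in> \<real>\<^sub>\<ge>\<^sub>0"
        by (simp add: algebra_simps)
      moreover have "K ?u ?u - K ?u' ?u - K ?u ?u' + K ?u' ?u' = p x x * complex_of_real (\<Sum>t<m. (cmod (\<beta> t - \<beta>' t))\<^sup>2)"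
        unfolding sq[symmetric] by (simp add: K_def algebra_simps)
      ultimately have "p x x * complex_of_real (\<Sum>t<m. (cmod (\<beta> t - \<beta>' t))\<^sup>2)
          - complex_of_real (\<Sum>q\<in>T. (cmod (v ?u q - v ?u' q))\<^sup>2) \<in> \<real>\<^sub>\<ge>\<^sub>0"
        by (simp only: sq)
      then show ?thesis by (simp add: complex_nonneg_Reals_iff del: of_real_sum)
    qed
    have "\<exists>\<beta>. \<forall>t<m. v (x, \<beta>, a) (Inl t) = \<beta> t" if x: "x \<in> X" and a: "a < N" for x a
    proof (rule contraction_fixed_point)
      show "0 \<le> Re (p x x)" "Re (p x x) < 1" using kernel_on_diag_real(2)[OF p x] p1[OF x] by auto
      show "(\<Sum>t<m. (cmod (v (x, \<beta>, a) (Inl t) - v (x, \<beta>', a) (Inl t)))\<^sup>2) \<le> Re (p x x) * (\<Sum>t<m. (cmod (\<beta> t - \<beta>' t))\<^sup>2)"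
        for \<beta> \<beta>'
        using dist[OF x a, of \<beta> \<beta>'] by (simp add: sumT) (smt (verit) sum_nonneg zero_le_power2)
    qed
    then obtain B where B: "\<And>x a t. x \<in> X \<Longrightarrow> a < N \<Longrightarrow> t < m \<Longrightarrow> v (x, B x a, a) (Inl t) = B x a t"
      by metis
    define \<Phi> where "\<Phi> x a c = v (x, B x a, a) (Inr c)" for x a c
    define \<Delta> where "\<Delta> = (\<lambda>(x, a) (y, b). p x y * (\<Sum>t<m. B x a t * cnj (B y b t)) + \<delta> a b
        - (\<Sum>t<m. B x a t * cnj (B y b t)) - (\<Sum>c<N. \<Phi> x a c * cnj (\<Phi> y b c)))"
    have \<Delta>: "kernel_on (X \<times> {..<N}) \<Delta>"
    proof (rule kernel_on_cong)
      show "kernel_on (X \<times> {..<N}) (\<lambda>u u'. (\<lambda>w w'. K w w' - (\<Sum>q\<in>T. v w q * cnj (v w' q)))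
          (fst u, B (fst u) (snd u), snd u) (fst u', B (fst u') (snd u'), snd u'))"
        by (rule kernel_on_pullback[OF D]) (auto simp: U_def)
    qed (auto simp: K_def \<Delta>_def sumT B \<Phi>_def)
    have "kernel_on (X \<times> {..<N}) (\<lambda>u u'. (\<Sum>t<m. (f (fst u) * B (fst u) (snd u) t) * cnj (f (fst u') * B (fst u') (snd u') t))
        + s (fst u) (fst u') * \<Delta> u u')"
      by (intro kernel_on_add kernel_on_mult kernel_on_sum kernel_on_rank_one \<Delta> kernel_on_pullback[OF s]) auto
    then have "kernel_on (X \<times> {..<N})
      (\<lambda>(x, a) (y, b). s x y * ((if a = b then 1 else 0) - (\<Sum>c<N. \<Phi> x a c * cnj (\<Phi> y b c))))"
    proof (rule kernel_on_cong)
      fix u u' assume "u \<in> X \<times> {..<N}" "u' \<in> X \<times> {..<N}"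
      then obtain x a y b where u: "u = (x, a)" "u' = (y, b)" "x \<in> X" "y \<in> X" by auto
      define \<sigma> where "\<sigma> = (\<Sum>t<m. B x a t * cnj (B y b t))"
      have "(\<Sum>t<m. (f x * B x a t) * cnj (f y * B y b t)) = f x * cnj (f y) * \<sigma>"
        by (simp add: \<sigma>_def sum_distrib_left mult_ac)
      also have "\<dots> = s x y * ((1 - p x y) * \<sigma>)" using ne[OF u(3,4)] by (simp add: s_def)
      finally show "(\<Sum>t<m. (f (fst u) * B (fst u) (snd u) t) * cnj (f (fst u') * B (fst u') (snd u') t))
        + s (fst u) (fst u') * \<Delta> u u' =
        (\<lambda>(x, a) (y, b). s x y * ((if a = b then 1 else 0) - (\<Sum>c<N. \<Phi> x a c * cnj (\<Phi> y b c)))) u u'"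
        unfolding u by (simp add: \<Delta>_def \<sigma>_def[symmetric] algebra_simps) (simp add: \<delta>_def)
    qed
    then have "contractive_multiplier X s N \<Phi>" by (rule contractive_multiplier_if_kernel[OF s])
    moreover have "\<Phi> (z i) a c = W i a c" if "i < n" "a < N" "c < N" for i a c
    proof -
      have ia: "(i, a) \<in> I" and zi: "z i \<in> X" using that z by (auto simp: I_def)
      let ?S = "\<Sum>t<m. (cmod (B (z i) a t - b (i, a) t))\<^sup>2"
      let ?R = "\<Sum>c<N. (cmod (\<Phi> (z i) a c - W i a c))\<^sup>2"
      have "v (z i, b (i, a), a) (Inl t) = b (i, a) t" if "t < m" for t
        using v\<alpha>[OF ia, of "Inl t"] that by (auto simp: \<alpha>_def y_def T_def)
      moreover have "v (z i, b (i, a), a) (Inr c) = W i a c" if "c < N" for c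
        using v\<alpha>[OF ia, of "Inr c"] that by (auto simp: \<alpha>_def y_def T_def)
      ultimately have "(\<Sum>q\<in>T. (cmod (v (z i, B (z i) a, a) q - v (z i, b (i, a), a) q))\<^sup>2) = ?S + ?R"
        by (simp add: sumT B[OF zi that(2)] \<Phi>_def)
      then have "?S + ?R \<le> Re (p (z i) (z i)) * ?S" using dist[OF zi that(2), of "B (z i) a" "b (i, a)"] by simp
      moreover have "Re (p (z i) (z i)) * ?S \<le> ?S"
        using p1[OF zi] by (intro mult_left_le_one_le sum_nonneg kernel_on_diag_real(2)[OF p zi]) auto
      ultimately have "?R \<le> 0" by linarith
      then have "?R = 0" by (intro antisym sum_nonneg) auto
      then show ?thesis using that(3) by (simp add: sum_nonneg_eq_0_iff)
    qed
    ultimately show ?thesis by blast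
  qed
  with s have "complete_pick_kernel X s" unfolding complete_pick_kernel_def by blast
  then show ?thesis by (simp add: s_def[abs_def])
qed

section \<open>Necessity: the quotients of a complete Pick kernel\<close>

text \<open>
  Induction on the number of points.  If \<open>p\<close> is a factor for the points found so far, write it as
  \<open>p(x,y) = w(x) w(y)\<^sup>*\<close> with row vectors \<open>w\<close>.  Then \<open>s (1 - w w\<^sup>*)\<close> is the rank one kernel
  \<open>s(x,z) s(z,y) / s(z,z)\<close>, so \<open>w\<close> satisfies the Pick condition and extends to the new point by a
  contractive multiplier.  The extended kernel \<open>R\<close> is positive and of rank one on the old points,
  which forces its entries between old and new points to follow the same formula; in the new diagonal
  entry there is only an inequality, which goes in the right direction and is repaired by adding
  \<open>\<rho>\<close>.  The factor is characterised by a product instead of a quotient because \<open>s\<close> may vanish off the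
  diagonal.
\<close>
lemma complete_pick_kernel_factor_finite:
  assumes cp: "complete_pick_kernel X s" and s0: "\<And>x. x \<in> X \<Longrightarrow> s x x \<noteq> 0" and z: "z \<in> X"
    and "finite A" "A \<subseteq> X"
  shows "\<exists>p. kernel_on (insert z A) p \<and>
    (\<forall>x\<in>insert z A. \<forall>y\<in>insert z A. s x y * p x y = kernel_at s z x y)"
  using assms(4,5)
proof (induction A rule: finite_induct)
  case empty
  show ?case
    by (rule exI[of _ "\<lambda>_ _. 0"]) (simp add: kernel_on_zero kernel_at_def s0[OF z])
next
  case (insert x0 A)
  have s: "kernel_on X s" using cp by (simp add: complete_pick_kernel_def)
  define A' where "A' = insert z A"
  obtain p where pA: "kernel_on A' p"
    and sp: "\<And>x y. x \<in> A' \<Longrightarrow> y \<in> A' \<Longrightarrow> s x y * p x y = kernel_at s z x y"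
    using insert.IH insert.prems unfolding A'_def by blast
  have A': "finite A'" "A' \<subseteq> X" "z \<in> A'" and x0: "x0 \<in> X"
    using insert z by (auto simp: A'_def)
  show ?case
  proof (cases "x0 \<in> A'")
    case True
    then have "insert z (insert x0 A) = A'" by (auto simp: A'_def)
    then show ?thesis using pA sp by auto
  next
    case False
      define N where "N = card A'"
      have N: "N \<ge> 1" using A' by (auto simp: N_def Suc_le_eq card_gt_0_iff)
      obtain h where h: "bij_betw h {..<N} A'"
        using A'(1) ex_bij_betw_nat_finite atLeast0LessThan N_def by metis
      have hA: "h i \<in> A'" if "i < N" for i using bij_betwE[OF h] that by auto
      then have hX: "h i \<in> X" if "i < N" for i using A'(2) that by auto
      obtain w :: "'a \<Rightarrow> nat \<Rightarrow> complex" where w: "\<And>x y. x \<in> A' \<Longrightarrow> y \<in> A' \<Longrightarrow> p x y = (\<Sum>t<N. w x t * cnj (w y t))"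
        using kernel_on_factorization[OF A'(1) order_refl pA] unfolding N_def by blast
      \<comment> \<open>The complete Pick property is about square matrices, so the row vectors are padded with zero rows.\<close>
      define W where "W i a c = (if a = 0 then w (h i) c else 0)" for i a c :: nat
      define E where "E e x y = (if e = 0 then s x z * s z y / s z z else s x y)" for e :: nat and x y
      have E: "kernel_on X (E e)" for e
      proof (cases "e = 0")
        case True
        show ?thesis by (rule kernel_on_cong[OF kernel_on_rank_one_at[OF s z]]) (simp add: E_def True)
      next
        case False
        then show ?thesis by (intro kernel_on_cong[OF s]) (simp add: E_def)
      qed
      have "kernel_on ({..<N} \<times> {..<N}) (pick_matrix s N h W)"
      proof (rule kernel_on_cong)
        show "kernel_on ({..<N} \<times> {..<N}) (\<lambda>u u'. \<Sum>e<N. (if snd u = e then 1 else 0) *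
            E e (h (fst u)) (h (fst u')) * cnj (if snd u' = e then 1 else 0))"
          by (intro kernel_on_sum kernel_on_conjugate kernel_on_pullback[OF E]) (auto intro: hX)
        fix u u' assume "u \<in> {..<N} \<times> {..<N}" "u' \<in> {..<N} \<times> {..<N}"
        then obtain i a j b where u: "u = (i, a)" "u' = (j, b)" "i < N" "a < N" "j < N" "b < N" by auto
        have "(\<Sum>e<N. (if snd u = e then 1 else 0) *
            E e (h (fst u)) (h (fst u')) * cnj (if snd u' = e then 1 else 0)) =
            (\<Sum>e<N. if a = e then E a (h i) (h j) * (if b = a then 1 else 0) else 0)"
          by (intro sum.cong) (auto simp: u)
        also have "\<dots> = E a (h i) (h j) * (if b = a then 1 else 0)" using u by simp
        also have "\<dots> = pick_matrix s N h W u u'"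
        proof (cases "a = 0 \<and> b = 0")
          case True
          then have "(\<Sum>c<N. W i a c * cnj (W j b c)) = p (h i) (h j)" using w hA u by (simp add: W_def)
          then show ?thesis using True sp[OF hA hA, of i j] u
            by (simp add: pick_matrix_def E_def kernel_at_def right_diff_distrib)
        next
          case False
          then have "(\<Sum>c<N. W i a c * cnj (W j b c)) = 0" by (auto simp: W_def)
          then show ?thesis using False by (auto simp: pick_matrix_def E_def u)
        qed
        finally show "(\<Sum>e<N. (if snd u = e then 1 else 0) *
            E e (h (fst u)) (h (fst u')) * cnj (if snd u' = e then 1 else 0)) = pick_matrix s N h W u u'" .
      qed
      then have "psd_matrix ({..<N} \<times> {..<N}) (pick_matrix s N h W)" by (simp add: kernel_on_finite_iff)
      moreover have "\<forall>i<N. h i \<in> X" using hX by simp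
      ultimately have "\<exists>\<Phi>. contractive_multiplier X s N \<Phi> \<and> (\<forall>i<N. \<forall>a<N. \<forall>b<N. \<Phi> (h i) a b = W i a b)"
        using conjunct2[OF cp[unfolded complete_pick_kernel_def], rule_format, of N N h W] N by simp
      then obtain \<Phi> where cm: "contractive_multiplier X s N \<Phi>"
        and \<Phi>: "\<And>i a b. i < N \<Longrightarrow> a < N \<Longrightarrow> b < N \<Longrightarrow> \<Phi> (h i) a b = W i a b"
        by blast
      define q where "q x y = (\<Sum>c<N. \<Phi> x 0 c * cnj (\<Phi> y 0 c))" for x y
      define R where "R x y = s x y * (1 - q x y)" for x y
      have q: "kernel_on X q" unfolding q_def by (intro kernel_on_sum kernel_on_rank_one)
      have "kernel_on X (\<lambda>x y. (\<lambda>(x, a) (y, b). s x y * ((if a = b then 1 else 0) - (\<Sum>c<N. \<Phi> x a c * cnj (\<Phi> y b c)))) (x, 0) (y, 0))"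
        by (rule kernel_on_pullback[OF kernel_if_contractive_multiplier[OF cm]]) (use N in auto)
      then have R: "kernel_on X R" by (simp add: R_def[abs_def] q_def)
      have qA: "q x y = p x y" if xy: "x \<in> A'" "y \<in> A'" for x y
      proof -
        obtain i j where ij: "x = h i" "y = h j" "i < N" "j < N"
          using xy bij_betw_imp_surj_on[OF h] by auto
        then show ?thesis using N w[OF xy] by (simp add: q_def \<Phi> W_def)
      qed
      have "s z z * q z z = 0" using sp[OF A'(3) A'(3)] qA[OF A'(3) A'(3)] by (simp add: kernel_at_base[OF s z z])
      then have "q z z = 0" using s0[OF z] by simp
      then have Rz: "R z y = s z y" "R y z = s y z" if "y \<in> X" for y
        using kernel_on_diag_zero[OF q that z] by (auto simp: R_def)
      have Rat: "s x y * q x y + kernel_at R z x y = kernel_at s z x y" if "x \<in> X" "y \<in> X" for x y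
      proof -
        have "kernel_at R z x y = R x y - s x z * s z y / s z z"
          unfolding kernel_at_def by (simp only: Rz that z)
        then show ?thesis by (simp add: R_def kernel_at_def right_diff_distrib)
      qed
      have Rk: "kernel_on X (kernel_at R z)" by (rule kernel_on_kernel_at[OF R z])
      have eq0: "kernel_at R z x y = 0" if x: "x \<in> A'" and y: "y \<in> X" for x y
      proof -
        have xX: "x \<in> X" using x A' by auto
        have "kernel_at R z x x = 0" using Rat[OF xX xX] qA[OF x x] sp[OF x x] by simp
        from kernel_on_diag_zero(2)[OF Rk y xX this] show ?thesis .
      qed
      have eq0': "kernel_at R z y x = 0" if x: "x \<in> A'" and y: "y \<in> X" for x y
        using kernel_on_hermitian[OF Rk, of x y] eq0[OF x y] x y A'(2) by auto
      define \<rho> where "\<rho> = kernel_at R z x0 x0 / s x0 x0"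
      have \<rho>: "\<rho> \<in> \<real>\<^sub>\<ge>\<^sub>0"
        unfolding \<rho>_def by (intro nonneg_Reals_divide_I kernel_on_diag[OF Rk x0] kernel_on_diag[OF s x0])
      define p' where "p' x y = q x y + \<rho> * ((if x = x0 then 1 else 0) * cnj (if y = x0 then 1 else 0))" for x y
      have sub: "insert x0 A' \<subseteq> X" using x0 A'(2) by auto
      have "kernel_on (insert x0 A') p'"
        unfolding p'_def by (intro kernel_on_add kernel_on_scale[OF kernel_on_rank_one \<rho>] kernel_on_subset[OF q sub])
      moreover have "s x y * p' x y = kernel_at s z x y" if xy: "x \<in> insert x0 A'" "y \<in> insert x0 A'" for x y
      proof -
        have X: "x \<in> X" "y \<in> X" using xy sub by auto
        have "s x y * p' x y = s x y * q x y + kernel_at R z x y"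
        proof (cases "x = x0 \<and> y = x0")
          case True
          then show ?thesis using s0[OF x0] by (simp add: p'_def \<rho>_def distrib_left)
        next
          case False
          then have "kernel_at R z x y = 0" using xy eq0[OF _ X(2)] eq0'[OF _ X(1)] by auto
          then show ?thesis using False by (auto simp: p'_def)
        qed
        then show ?thesis using Rat[OF X] by simp
      qed
      moreover have "insert z (insert x0 A) = insert x0 A'" by (auto simp: A'_def)
      ultimately show ?thesis by (intro exI[of _ p']) simp
  qed
qed

text \<open>
  If \<open>s x y = 0\<close>, then the Schur complement \<open>s\<^sup>z\<close>, being a multiple of \<open>s\<close>, also vanishes at
  \<open>(x, y)\<close>.
\<close>
lemma complete_pick_kernel_nonzero_trans:
  assumes "complete_pick_kernel X s" "\<And>x. x \<in> X \<Longrightarrow> s x x \<noteq> 0" "x \<in> X" "y \<in> X" "z \<in> X"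
    and nz: "s x z \<noteq> 0" "s z y \<noteq> 0"
  shows "s x y \<noteq> 0"
proof
  assume "s x y = 0"
  moreover obtain p where "s x y * p x y = kernel_at s z x y"
    using complete_pick_kernel_factor_finite[OF assms(1,2,5), of "{x, y}"] assms(3,4) by auto
  ultimately show False using nz assms(2)[OF \<open>z \<in> X\<close>] by (simp add: kernel_at_def)
qed

lemma complete_pick_kernel_quotient:
  assumes cp: "complete_pick_kernel X s" and ne: "\<And>x y. x \<in> X \<Longrightarrow> y \<in> X \<Longrightarrow> s x y \<noteq> 0" and z: "z \<in> X"
  shows "kernel_on X (\<lambda>x y. kernel_at s z x y / s x y)"
proof (rule kernel_onI)
  fix A c assume A: "finite A" "A \<subseteq> X"
  obtain p where p: "kernel_on (insert z A) p"
    and sp: "\<And>x y. x \<in> insert z A \<Longrightarrow> y \<in> insert z A \<Longrightarrow> s x y * p x y = kernel_at s z x y"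
    using complete_pick_kernel_factor_finite[OF cp ne z A] by blast
  have "p x y = kernel_at s z x y / s x y" if "x \<in> insert z A" "y \<in> insert z A" for x y
  proof -
    have "s x y \<noteq> 0" using ne that z A(2) by auto
    then show ?thesis using sp[OF that, symmetric] by simp
  qed
  then have "kernel_on (insert z A) (\<lambda>x y. kernel_at s z x y / s x y)"
    by (rule kernel_on_cong[OF p])
  then show "(\<Sum>x\<in>A. \<Sum>y\<in>A. cnj (c x) * (kernel_at s z x y / s x y) * c y) \<in> \<real>\<^sub>\<ge>\<^sub>0"
    by (rule kernel_onD[OF _ A(1) subset_insertI])
qed

section \<open>The identity theorem in several variables\<close>

lemma bounded_linear_smult_vector:
  fixes v :: "complex ^ 'd"
  shows "bounded_linear (\<lambda>t. t *s v)"
proof -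
  have "linear (\<lambda>t. t *s v)"
    by (rule linearI) (auto simp: vec_eq_iff algebra_simps)
  then show ?thesis by (simp add: linear_conv_bounded_linear)
qed

lemma holomorphic_on_Cd_line:
  fixes a v :: "complex ^ 'd"
  assumes f: "holomorphic_on_Cd f \<Omega>" and \<Omega>: "open \<Omega>" and S: "\<And>t. t \<in> S \<Longrightarrow> a + t *s v \<in> \<Omega>"
  shows "(\<lambda>t. f (a + t *s v)) holomorphic_on S"
proof (rule holomorphic_onI)
  fix t assume t: "t \<in> S"
  obtain f' where "(f has_derivative f') (at (a + t *s v) within \<Omega>)" and lin: "\<forall>c u. f' (c *s u) = c * f' u"
    using bspec[OF f[unfolded holomorphic_on_Cd_def] S[OF t]] by blast
  then have f': "(f has_derivative f') (at (a + t *s v))"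
    by (simp only: at_within_open[OF S[OF t] \<Omega>])
  have "((\<lambda>h. h *s v) has_derivative (\<lambda>h. h *s v)) (at t)"
    by (rule bounded_linear_imp_has_derivative[OF bounded_linear_smult_vector])
  from has_derivative_add[OF has_derivative_const[of a] this]
  have "((\<lambda>h. a + h *s v) has_derivative (\<lambda>h. h *s v)) (at t)" by simp
  from diff_chain_at[OF this f'] have "((\<lambda>t. f (a + t *s v)) has_derivative (\<lambda>h. f' v * h)) (at t)"
    by (simp add: o_def lin mult.commute)
  then have "((\<lambda>t. f (a + t *s v)) has_field_derivative f' v) (at t)"
    by (simp add: has_field_derivative_def)
  then show "(\<lambda>t. f (a + t *s v)) field_differentiable at t within S"
    using field_differentiable_at_within field_differentiable_def by blast
qed

text \<open>
  Restrict to the complex line through \<open>a\<close> and \<open>x\<close>, which meets the ball in a convex set, and use the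
  identity theorem in one variable.
\<close>
lemma holomorphic_on_Cd_zero_on_ball:
  fixes a b x :: "complex ^ 'd"
  assumes f: "holomorphic_on_Cd f \<Omega>" and \<Omega>: "open \<Omega>" and ball: "ball b r \<subseteq> \<Omega>"
    and a: "a \<in> ball b r" and x: "x \<in> ball b r" and zero: "\<forall>\<^sub>F y in nhds a. f y = 0"
  shows "f x = 0"
proof -
  define L where "L t = a + t *s (x - a)" for t :: complex
  define S where "S = L -` ball b r"
  obtain V where V: "open V" "a \<in> V" "\<And>y. y \<in> V \<Longrightarrow> f y = 0"
    using zero unfolding eventually_nhds by blast
  have cont: "continuous_on UNIV L"
    unfolding L_def by (intro continuous_on_add continuous_on_const bounded_linear.continuous_on[OF bounded_linear_smult_vector] continuous_on_id)
  have "open S" unfolding S_def by (intro open_vimage cont) simp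
  have comb: "L (u *\<^sub>R t1 + w *\<^sub>R t2) = u *\<^sub>R L t1 + w *\<^sub>R L t2" if "u + w = 1" for u w t1 t2
  proof -
    have w: "w = 1 - u" using that by simp
    show ?thesis unfolding w by (auto simp: L_def vec_eq_iff complex_eq_iff algebra_simps)
  qed
  have "convex S"
    unfolding S_def convex_def using convexD[OF convex_ball[of b r]] by (auto simp: comb)
  have S01: "0 \<in> S" "1 \<in> S" using a x by (auto simp: S_def L_def)
  have hol: "(\<lambda>t. f (L t)) holomorphic_on S"
    unfolding L_def using ball by (intro holomorphic_on_Cd_line[OF f \<Omega>]) (auto simp: S_def L_def)
  have "f (L 1) = 0"
  proof (rule analytic_continuation_open[of "S \<inter> L -` V" S "\<lambda>t. f (L t)" "\<lambda>_. 0"])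
    show "open (S \<inter> L -` V)" by (intro open_Int \<open>open S\<close> open_vimage V cont)
    show "S \<inter> L -` V \<noteq> {}" using S01(1) V(2) by (auto simp: L_def)
  qed (use \<open>open S\<close> convex_connected[OF \<open>convex S\<close>] S01 hol V(3) in auto)
  then show ?thesis by (simp add: L_def)
qed

text \<open>
  By the previous lemma, vanishing near a point spreads over balls, hence over the connected domain.
\<close>
lemma holomorphic_on_Cd_nonzero_dense:
  fixes \<Omega> :: "(complex ^ 'd) set"
  assumes \<Omega>: "domain_Cd \<Omega>" and f: "holomorphic_on_Cd f \<Omega>" and z: "z \<in> \<Omega>" "f z \<noteq> 0"
    and V: "open V" "w \<in> V" "w \<in> \<Omega>"
  shows "\<exists>v\<in>V. f v \<noteq> 0"
proof (rule ccontr)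
  assume "\<not> (\<exists>v\<in>V. f v \<noteq> 0)"
  then have w: "\<forall>\<^sub>F y in nhds w. f y = 0" using V by (auto simp: eventually_nhds)
  have \<Omega>': "open \<Omega>" "connected \<Omega>" using \<Omega> by (auto simp: domain_Cd_def)
  have "\<forall>\<^sub>F y in nhds z. f y = 0"
  proof (rule connected_induction_simple[where P = "\<lambda>a. \<forall>\<^sub>F y in nhds a. f y = 0", OF \<Omega>'(2) V(3) z(1) w])
    fix a assume "a \<in> \<Omega>"
    then obtain r where r: "r > 0" "ball a r \<subseteq> \<Omega>" using \<Omega>'(1) by (auto simp: open_contains_ball)
    have "\<forall>\<^sub>F u in nhds y. f u = 0" if "x \<in> ball a r" "y \<in> ball a r" "\<forall>\<^sub>F u in nhds x. f u = 0" for x y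
      using eventually_nhds_in_open[OF open_ball that(2)]
      by (rule eventually_mono) (rule holomorphic_on_Cd_zero_on_ball[OF f \<Omega>'(1) r(2) that(1) _ that(3)])
    moreover have "openin (top_of_set \<Omega>) (ball a r)" by (rule open_subset[OF r(2) open_ball])
    ultimately show "\<exists>T. openin (top_of_set \<Omega>) T \<and> a \<in> T \<and> (\<forall>x\<in>T. \<forall>y\<in>T. (\<forall>\<^sub>F u in nhds x. f u = 0) \<longrightarrow> (\<forall>\<^sub>F u in nhds y. f u = 0))"
      using r(1) centre_in_ball[of a r] by blast
  qed
  then have "f z = 0" by (rule eventually_nhds_x_imp_x)
  with z show False by simp
qed

lemma holomorphic_on_Cd_nonzero_open:
  assumes \<Omega>: "open \<Omega>" and f: "holomorphic_on_Cd f \<Omega>"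
  shows "open {x \<in> \<Omega>. f x \<noteq> 0}"
proof -
  have "continuous_on \<Omega> f"
    using f has_derivative_continuous unfolding holomorphic_on_Cd_def continuous_on_eq_continuous_within by blast
  from continuous_open_preimage[OF this \<Omega> open_Compl[OF closed_singleton[of 0]]] show ?thesis
    by (simp add: vimage_def Int_def)
qed

section \<open>Translation between the two certificates\<close>

text \<open>
  With \<open>c = h z z\<close>, the kernel is the sum of \<open>h\<^sup>z\<close> and the rank one kernel
  \<open>(h(x,z) - c) (h(y,z) - c)\<^sup>* / (c (1 - c))\<close>.  For \<open>c = 0\<close> it is \<open>h\<close> itself.
\<close>
lemma kernel_on_complement_quotient:
  assumes h: "kernel_on X h" and z: "z \<in> X" and h1: "Re (h z z) < 1"
  shows "kernel_on X (\<lambda>x y. (1 - h x z) * (1 - h z y) / (1 - h z z) - (1 - h x y))"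
proof (cases "h z z = 0")
  case True
  then show ?thesis
    using kernel_on_diag_zero[OF h _ z] by (intro kernel_on_cong[OF h]) simp
next
  case False
  define c where "c = Re (h z z)"
  have c: "h z z = complex_of_real c" "0 < c" "c < 1"
    using kernel_on_diag_real[OF h z] False h1 by (auto simp: c_def order_le_less)
  have "complex_of_real (1 / (c * (1 - c))) \<in> \<real>\<^sub>\<ge>\<^sub>0"
    using c by (subst nonneg_Reals_of_real_iff) simp
  then have "kernel_on X (\<lambda>x y. kernel_at h z x y + complex_of_real (1 / (c * (1 - c))) * ((h x z - c) * cnj (h y z - c)))"
    by (intro kernel_on_add kernel_on_kernel_at[OF h z] kernel_on_scale[OF kernel_on_rank_one])
  then show ?thesis
  proof (rule kernel_on_cong)
    fix x y assume "x \<in> X" "y \<in> X"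
    then have "cnj (h y z) = h z y" using kernel_on_hermitian[OF h _ z] by simp
    moreover have "complex_of_real c \<noteq> 0" "1 - complex_of_real c \<noteq> 0"
      using c by (auto simp: complex_eq_iff)
    ultimately show "kernel_at h z x y + complex_of_real (1 / (c * (1 - c))) * ((h x z - c) * cnj (h y z - c)) =
        (1 - h x z) * (1 - h z y) / (1 - h z z) - (1 - h x y)"
      by (simp add: kernel_at_def c(1) divide_simps) (simp add: algebra_simps)
  qed
qed

text \<open>
  With \<open>p = s\<^sup>z / s\<close> and the rank one kernel \<open>r(x,y) = s(x,z) s(z,y) / s(z,z)\<close>, one finds
  \<open>l\<^sup>z - p l = r g\<^sup>z\<close>, and \<open>p k - k\<^sup>z\<close> is the product of \<open>r\<close> with the kernel of
  \<open>kernel_on_complement_quotient\<close>.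
\<close>
lemma shimorin_if_strong:
  assumes s: "complete_pick_kernel X s" and ne: "\<And>x y. x \<in> X \<Longrightarrow> y \<in> X \<Longrightarrow> s x y \<noteq> 0"
    and h: "kernel_on X h" and g: "kernel_on X g" and k: "kernel_on X k"
    and ks: "\<And>x y. x \<in> X \<Longrightarrow> y \<in> X \<Longrightarrow> k x y = (1 - h x y) * s x y"
    and ls: "\<And>x y. x \<in> X \<Longrightarrow> y \<in> X \<Longrightarrow> l x y = s x y * g x y"
    and k0: "\<And>z. z \<in> X \<Longrightarrow> k z z \<noteq> 0" and l0: "\<And>z. z \<in> X \<Longrightarrow> l z z \<noteq> 0"
  shows "has_shimorin_certificate X k l"
  unfolding has_shimorin_certificate_def
proof (intro exI[of _ "\<lambda>z x y. kernel_at s z x y / s x y"] ballI conjI)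
  fix z assume z: "z \<in> X"
  show "kernel_on X (\<lambda>x y. kernel_at s z x y / s x y)"
    by (rule complete_pick_kernel_quotient[OF s ne z])
  have s': "kernel_on X s" using s by (simp add: complete_pick_kernel_def)
  note rk = kernel_on_rank_one_at[OF s' z]
  have gz: "g z z \<noteq> 0" using l0[OF z] ls[OF z z] by auto
  have hz: "1 - h z z \<noteq> 0" using k0[OF z] ks[OF z z] by auto
  have h1: "Re (h z z) < 1"
  proof -
    have "(1 - h z z) = k z z / s z z" using ks[OF z z] ne[OF z z] by simp
    also have "\<dots> \<in> \<real>\<^sub>\<ge>\<^sub>0"
      by (intro nonneg_Reals_divide_I kernel_on_diag[OF k z] kernel_on_diag[OF s' z])
    finally show ?thesis using hz kernel_on_diag[OF h z]
      by (auto simp: complex_nonneg_Reals_iff complex_eq_iff)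
  qed
  show "kernel_le X (\<lambda>w v. kernel_at s z w v / s w v * l w v) (kernel_at l z)"
    unfolding kernel_le_def
    by (rule kernel_on_cong[OF kernel_on_mult[OF rk kernel_on_kernel_at[OF g z]]])
       (use ne z gz in \<open>simp add: kernel_at_def ls divide_simps\<close>, simp add: algebra_simps)
  show "kernel_le X (kernel_at k z) (\<lambda>w v. kernel_at s z w v / s w v * k w v)"
    unfolding kernel_le_def
    by (rule kernel_on_cong[OF kernel_on_mult[OF rk kernel_on_complement_quotient[OF h z h1]]])
       (use ne z hz in \<open>simp add: kernel_at_def ks divide_simps\<close>, simp add: algebra_simps)
qed

text \<open>
  Dividing the two conditions at \<open>z\<close> by \<open>f(x) f(y)\<^sup>* = k(x,z) k(z,y) / k(z,z)\<close> turns the second one into the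
  positivity of \<open>h\<close>; the first one gives the positivity of \<open>g\<close> after adding
  \<open>l(x,z) l(z,y) / l(z,z)\<close>.
\<close>
lemma strong_if_shimorin_at:
  assumes k: "kernel_on X k" and l: "kernel_on X l" and z: "z \<in> X"
    and p: "kernel_on X p" and p1: "\<And>x. x \<in> X \<Longrightarrow> Re (p x x) < 1"
    and pl: "kernel_le X (\<lambda>w v. p w v * l w v) (kernel_at l z)"
    and pk: "kernel_le X (kernel_at k z) (\<lambda>w v. p w v * k w v)"
    and k0: "\<And>x. x \<in> X \<Longrightarrow> k x z \<noteq> 0"
  shows "has_strong_shimorin_certificate X k l"
proof -
  define r where "r = complex_of_real (sqrt (Re (k z z)))"
  have rr: "r * r = k z z" "cnj r = r"
    using kernel_on_diag_real[OF k z] by (simp_all add: r_def flip: of_real_mult)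
  have r0: "r \<noteq> 0" using rr(1) k0[OF z] by auto
  define f where "f x = k x z / r" for x
  have f0: "f x \<noteq> 0" if "x \<in> X" for x using k0[OF that] r0 by (simp add: f_def)
  have ff: "f x * cnj (f y) = k x z * k z y / k z z" if "x \<in> X" "y \<in> X" for x y
    using kernel_on_hermitian[OF k that(2) z] rr by (simp add: f_def flip: rr(1))
  have ne: "1 - p x y \<noteq> 0" if "x \<in> X" "y \<in> X" for x y
    using kernel_on_norm_less_one[OF p p1 that] by auto
  define s where "s x y = f x * cnj (f y) / (1 - p x y)" for x y
  define h where "h x y = 1 - (1 - p x y) * k x y / (f x * cnj (f y))" for x y
  define g where "g x y = (1 - p x y) * l x y / (f x * cnj (f y))" for x y
  have "complete_pick_kernel X s"
    unfolding s_def by (rule complete_pick_kernel_geometric[OF p p1 f0])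
  moreover have "kernel_on X h"
  proof (rule kernel_on_cong[OF kernel_on_conjugate[OF pk[unfolded kernel_le_def], of "\<lambda>x. 1 / f x"]])
    fix x y assume xy: "x \<in> X" "y \<in> X"
    have "p x y * k x y - kernel_at k z x y = f x * cnj (f y) - (1 - p x y) * k x y"
      unfolding ff[OF xy] by (simp add: kernel_at_def algebra_simps)
    then show "1 / f x * (p x y * k x y - kernel_at k z x y) * cnj (1 / f y) = h x y"
      using f0[OF xy(1)] f0[OF xy(2)] by (simp add: h_def divide_simps)
  qed
  moreover have "kernel_on X g"
  proof (rule kernel_on_cong[OF kernel_on_conjugate[OF kernel_on_add[OF pl[unfolded kernel_le_def] kernel_on_rank_one_at[OF l z]], of "\<lambda>x. 1 / f x"]])
    fix x y assume xy: "x \<in> X" "y \<in> X"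
    show "1 / f x * (kernel_at l z x y - p x y * l x y + l x z * l z y / l z z) * cnj (1 / f y) = g x y"
      using f0[OF xy(1)] f0[OF xy(2)] by (simp add: g_def kernel_at_def left_diff_distrib flip: diff_divide_distrib)
  qed
  moreover have "k x y = (1 - h x y) * s x y \<and> l x y = s x y * g x y" if "x \<in> X" "y \<in> X" for x y
    using f0[OF that(1)] f0[OF that(2)] ne[OF that] by (simp add: s_def h_def g_def)
  ultimately show ?thesis unfolding has_strong_shimorin_certificate_def by blast
qed

text \<open>
  The diagonal of the condition gives \<open>p(w,w) \<le> 1\<close>, strictly where \<open>l(w,z) \<noteq> 0\<close>.  Where equality holds, the
  diagonal entry at \<open>w\<close> of the positive kernel \<open>D = l\<^sup>z - p l\<close> is zero, hence so is its whole column;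
  since \<open>l(z,w) = 0\<close>, this says \<open>p(v,w) = 1\<close> whenever \<open>l(v,w) \<noteq> 0\<close>, in particular for \<open>v\<close> near
  \<open>w\<close>.  By the identity theorem one of these \<open>v\<close> has \<open>l(v,z) \<noteq> 0\<close>, hence \<open>p(v,v) < 1\<close>, in conflict with
  Cauchy-Schwarz.
\<close>
lemma shimorin_multiplier_less_one:
  fixes \<Omega> :: "(complex ^ 'd) set"
  assumes \<Omega>: "domain_Cd \<Omega>" and l: "holomorphic_kernel \<Omega> l" and l0: "\<And>z. z \<in> \<Omega> \<Longrightarrow> l z z \<noteq> 0"
    and z: "z \<in> \<Omega>" and p: "kernel_on \<Omega> p"
    and pl: "kernel_le \<Omega> (\<lambda>w v. p w v * l w v) (kernel_at l z)"
    and w: "w \<in> \<Omega>"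
  shows "Re (p w w) < 1"
proof (rule ccontr)
  assume "\<not> Re (p w w) < 1"
  have L: "kernel_on \<Omega> l" and hol: "\<And>v. v \<in> \<Omega> \<Longrightarrow> holomorphic_on_Cd (\<lambda>w. l w v) \<Omega>"
    using l by (auto simp: holomorphic_kernel_def)
  have "open \<Omega>" using \<Omega> by (simp add: domain_Cd_def)
  define D where "D x y = kernel_at l z x y - p x y * l x y" for x y
  have D: "kernel_on \<Omega> D" using pl by (simp add: kernel_le_def D_def[abs_def])
  have pos: "Re (l x x) > 0" if "x \<in> \<Omega>" for x
    using kernel_on_diag_real[OF L that] l0[OF that] by (auto simp: order_le_less)
  have bound: "(cmod (l x z))\<^sup>2 / Re (l z z) + Re (D x x) = (1 - Re (p x x)) * Re (l x x)" if x: "x \<in> \<Omega>" for x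
  proof -
    have "l x z * l z x / l z z = complex_of_real ((cmod (l x z))\<^sup>2 / Re (l z z))"
      using kernel_on_hermitian[OF L x z] kernel_on_diag_real(1)[OF L z]
      by (metis complex_norm_square of_real_divide)
    moreover have "Re (p x x * l x x) = Re (p x x) * Re (l x x)"
      using kernel_on_diag_real(1)[OF p x] kernel_on_diag_real(1)[OF L x]
      by (metis Re_complex_of_real of_real_mult)
    ultimately show ?thesis by (simp add: D_def kernel_at_def algebra_simps)
  qed
  have D0: "Re (D x x) \<ge> 0" if "x \<in> \<Omega>" for x by (rule kernel_on_diag_real(2)[OF D that])
  have "(1 - Re (p w w)) * Re (l w w) \<le> 0"
    using \<open>\<not> Re (p w w) < 1\<close> pos[OF w] by (simp add: mult_nonpos_nonneg)
  moreover have "(cmod (l w z))\<^sup>2 / Re (l z z) \<ge> 0" using pos[OF z] by simp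
  ultimately have "(cmod (l w z))\<^sup>2 / Re (l z z) = 0" "Re (D w w) = 0"
    using bound[OF w] D0[OF w] by linarith+
  then have lwz: "l w z = 0" and Dww: "D w w = 0"
    using pos[OF z] kernel_on_diag_real(1)[OF D w] by auto
  have pw: "p v w = 1" if "v \<in> \<Omega>" "l v w \<noteq> 0" for v
  proof -
    have "D v w = 0" by (rule kernel_on_diag_zero(1)[OF D that(1) w Dww])
    moreover have "l z w = 0" using kernel_on_hermitian[OF L w z] lwz by simp
    ultimately show ?thesis using that(2) by (simp add: D_def kernel_at_def)
  qed
  define V where "V = {v \<in> \<Omega>. l v w \<noteq> 0}"
  have "open V" unfolding V_def by (rule holomorphic_on_Cd_nonzero_open[OF \<open>open \<Omega>\<close> hol[OF w]])
  moreover have "w \<in> V" using w l0 by (simp add: V_def)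
  ultimately obtain v where v: "v \<in> V" "l v z \<noteq> 0"
    using holomorphic_on_Cd_nonzero_dense[OF \<Omega> hol[OF z] z l0[OF z] _ _ w] by blast
  then have v\<Omega>: "v \<in> \<Omega>" by (simp add: V_def)
  have "(cmod (p v w))\<^sup>2 \<le> Re (p v v) * Re (p w w)" by (rule kernel_on_cauchy_schwarz[OF p v\<Omega> w])
  moreover have "p v w = 1" "p w w = 1" using pw v w l0 by (auto simp: V_def)
  ultimately have "Re (p v v) \<ge> 1" by simp
  then have "(1 - Re (p v v)) * Re (l v v) \<le> 0" using pos[OF v\<Omega>] by (simp add: mult_nonpos_nonneg)
  moreover have "(cmod (l v z))\<^sup>2 / Re (l z z) > 0" using v(2) pos[OF z] by simp
  ultimately show False using bound[OF v\<Omega>] D0[OF v\<Omega>] by linarith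
qed

text \<open>
  If \<open>k(w,z) = 0\<close>, then the condition on the diagonal reads \<open>(p(w,w) - 1) k(w,w) \<ge> 0\<close>.
\<close>
lemma nonvanishing_if_shimorin_at:
  assumes k: "kernel_on X k" and z: "z \<in> X" and w: "w \<in> X" and kw: "k w w \<noteq> 0"
    and p: "kernel_on X p" and p1: "Re (p w w) < 1"
    and pk: "kernel_le X (kernel_at k z) (\<lambda>w v. p w v * k w v)"
  shows "k w z \<noteq> 0"
proof
  assume "k w z = 0"
  then have "Re (p w w * k w w - k w w) \<ge> 0"
    using kernel_on_diag_real(2)[OF pk[unfolded kernel_le_def] w] by (simp add: kernel_at_def)
  moreover have "Re (p w w * k w w) = Re (p w w) * Re (k w w)"
    using kernel_on_diag_real(1)[OF p w] kernel_on_diag_real(1)[OF k w]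
    by (metis Re_complex_of_real of_real_mult)
  moreover have "Re (k w w) > 0"
    using kernel_on_diag_real[OF k w] kw by (auto simp: order_le_less)
  ultimately have "(Re (p w w) - 1) * Re (k w w) \<ge> 0" "Re (k w w) > 0"
    by (simp_all only: left_diff_distrib minus_complex.sel mult_1_left)
  then show False using p1 by (simp add: zero_le_mult_iff)
qed

text \<open>
  The relation \<open>s(x,y) \<noteq> 0\<close> is an equivalence relation.  The class of \<open>a\<close> contains the
  neighbourhood of \<open>a\<close> where the continuous function \<open>k(.,a)\<close> is non-zero, since \<open>s\<close> divides \<open>k\<close>.
\<close>
lemma strong_factor_nonvanishing:
  fixes \<Omega> :: "(complex ^ 'd) set"
  assumes \<Omega>: "domain_Cd \<Omega>" and k: "holomorphic_kernel \<Omega> k" and k0: "\<And>z. z \<in> \<Omega> \<Longrightarrow> k z z \<noteq> 0"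
    and ks: "\<And>x y. x \<in> \<Omega> \<Longrightarrow> y \<in> \<Omega> \<Longrightarrow> k x y = (1 - h x y) * s x y"
    and s: "complete_pick_kernel \<Omega> s" and xy: "x \<in> \<Omega>" "y \<in> \<Omega>"
  shows "s x y \<noteq> 0"
proof -
  have \<Omega>': "open \<Omega>" "connected \<Omega>" using \<Omega> by (auto simp: domain_Cd_def)
  have s0: "s z z \<noteq> 0" if "z \<in> \<Omega>" for z using k0[OF that] ks[OF that that] by auto
  have sk: "kernel_on \<Omega> s" using s by (simp add: complete_pick_kernel_def)
  have "x \<in> \<Omega> \<and> y \<in> \<Omega> \<and> s x y \<noteq> 0"
  proof (rule connected_equivalence_relation[where R = "\<lambda>x y. x \<in> \<Omega> \<and> y \<in> \<Omega> \<and> s x y \<noteq> 0", OF \<Omega>'(2) xy])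
    show "v \<in> \<Omega> \<and> u \<in> \<Omega> \<and> s v u \<noteq> 0" if "u \<in> \<Omega> \<and> v \<in> \<Omega> \<and> s u v \<noteq> 0" for u v
      using that kernel_on_hermitian[OF sk, of u v] by auto
    show "u \<in> \<Omega> \<and> w \<in> \<Omega> \<and> s u w \<noteq> 0"
      if "u \<in> \<Omega> \<and> v \<in> \<Omega> \<and> s u v \<noteq> 0" "v \<in> \<Omega> \<and> w \<in> \<Omega> \<and> s v w \<noteq> 0" for u v w
      using that complete_pick_kernel_nonzero_trans[OF s s0] by blast
    show "\<exists>T. openin (top_of_set \<Omega>) T \<and> a \<in> T \<and> (\<forall>u\<in>T. a \<in> \<Omega> \<and> u \<in> \<Omega> \<and> s a u \<noteq> 0)"
      if a: "a \<in> \<Omega>" for a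
    proof (intro exI conjI)
      let ?T = "{u \<in> \<Omega>. k u a \<noteq> 0}"
      have "holomorphic_on_Cd (\<lambda>u. k u a) \<Omega>" using k a by (simp add: holomorphic_kernel_def)
      from holomorphic_on_Cd_nonzero_open[OF \<Omega>'(1) this] show "openin (top_of_set \<Omega>) ?T"
        by (intro open_subset) auto
      show "a \<in> ?T" using a k0 by simp
      show "\<forall>u\<in>?T. a \<in> \<Omega> \<and> u \<in> \<Omega> \<and> s a u \<noteq> 0"
        using a ks kernel_on_hermitian[OF sk, of _ a] by fastforce
    qed
  qed
  then show ?thesis by blast
qed

theorem proposition3p13:
  fixes \<Omega> :: "(complex ^ 'd) set"
    and k l :: "complex ^ 'd \<Rightarrow> complex ^ 'd \<Rightarrow> complex"
  assumes "domain_Cd \<Omega>"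
    and "holomorphic_kernel \<Omega> k"
    and "holomorphic_kernel \<Omega> l"
    and "\<forall>z\<in>\<Omega>. k z z \<noteq> 0"
    and "\<forall>z\<in>\<Omega>. l z z \<noteq> 0"
  shows "(has_shimorin_certificate \<Omega> k l \<longleftrightarrow> has_strong_shimorin_certificate \<Omega> k l) \<and>
         (has_shimorin_certificate \<Omega> k l \<longrightarrow> (\<forall>z\<in>\<Omega>. \<forall>w\<in>\<Omega>. k z w \<noteq> 0))"
proof -
  have k: "kernel_on \<Omega> k" and l: "kernel_on \<Omega> l"
    using assms(2,3) by (simp_all add: holomorphic_kernel_def)
  have k0: "k z z \<noteq> 0" and l0: "l z z \<noteq> 0" if "z \<in> \<Omega>" for z using assms(4,5) that by auto
  have fwd: "has_strong_shimorin_certificate \<Omega> k l \<and> (\<forall>z\<in>\<Omega>. \<forall>w\<in>\<Omega>. k z w \<noteq> 0)"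
    if "has_shimorin_certificate \<Omega> k l"
  proof -
    from that[unfolded has_shimorin_certificate_def]
    obtain p where cert: "\<forall>z\<in>\<Omega>. kernel_on \<Omega> (p z) \<and>
        kernel_le \<Omega> (\<lambda>w v. p z w v * l w v) (kernel_at l z) \<and>
        kernel_le \<Omega> (kernel_at k z) (\<lambda>w v. p z w v * k w v)" ..
    then have p: "kernel_on \<Omega> (p z)"
      and pl: "kernel_le \<Omega> (\<lambda>w v. p z w v * l w v) (kernel_at l z)"
      and pk: "kernel_le \<Omega> (kernel_at k z) (\<lambda>w v. p z w v * k w v)" if "z \<in> \<Omega>" for z
      using that by auto
    have p1: "Re (p z w w) < 1" if "z \<in> \<Omega>" "w \<in> \<Omega>" for z w
      by (rule shimorin_multiplier_less_one[OF assms(1,3) l0 that(1) p[OF that(1)] pl[OF that(1)] that(2)])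
    have nv: "k w z \<noteq> 0" if "z \<in> \<Omega>" "w \<in> \<Omega>" for z w
      by (rule nonvanishing_if_shimorin_at[OF k that k0[OF that(2)] p[OF that(1)] p1[OF that] pk[OF that(1)]])
    obtain z where z: "z \<in> \<Omega>" using assms(1) by (auto simp: domain_Cd_def)
    have "has_strong_shimorin_certificate \<Omega> k l"
      by (rule strong_if_shimorin_at[OF k l z p[OF z] p1[OF z] pl[OF z] pk[OF z] nv[OF z]])
    with nv show ?thesis by blast
  qed
  have bwd: "has_shimorin_certificate \<Omega> k l" if strong: "has_strong_shimorin_certificate \<Omega> k l"
  proof -
    obtain s h g where s: "complete_pick_kernel \<Omega> s" and h: "kernel_on \<Omega> h" and g: "kernel_on \<Omega> g"
      and kl: "\<forall>w\<in>\<Omega>. \<forall>v\<in>\<Omega>. k w v = (1 - h w v) * s w v \<and> l w v = s w v * g w v"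
      using strong unfolding has_strong_shimorin_certificate_def by (elim exE conjE)
    then have ks: "k w v = (1 - h w v) * s w v" and ls: "l w v = s w v * g w v"
      if "w \<in> \<Omega>" "v \<in> \<Omega>" for w v
      using that by auto
    show ?thesis
      by (rule shimorin_if_strong[OF s strong_factor_nonvanishing[OF assms(1,2) k0 ks s] h g k ks ls k0 l0])
  qed
  from fwd bwd show ?thesis by blast
qed

end
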